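(* There exists a deterministic polynomial-time algorithm that, for every sufficiently large input $x \in \mathbb{N}$, outputs an integer $m = \prod_{p \in S} p$, where $S$ is a set of distinct primes, satisfying $$ \frac{x}{2} < m < 2x, \qquad \frac{\varphi(m)}{m} = \Theta\left( \frac{1}{\log\log x} \right). $$
   Context: $\varphi$ is Euler's totient function and $\log$ denotes $\log_2$. "Polynomial-time" means running time (in bit operations on a deterministic multitape Turing machine) bounded by $(\log x)^{O(1)}$. $\Theta$ is as $x\to\infty$. *)

theory Defs
  imports "HOL-Number_Theory.Number_Theory" "HOL-Library.Landau_Symbols"
begin

text \<open>
  Deterministic multitape Turing machines. States are the numbers \<open>0, \<dots>, nstates M\<close>:
  state \<open>0\<close> is initial and \<open>nstates M\<close> is the unique halting state.
  Tape symbols are the numbers below \<open>nsyms M\<close>: \<open>0\<close> is the blank,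
  \<open>1\<close> and \<open>2\<close> are the binary digits zero and one, and any others are work symbols.
  From the current state and the list of scanned symbols, \<open>delta M\<close> yields the next state and,
  for each tape, the symbol to write and the head move.
\<close>

datatype dir = MoveL | Stay | MoveR

record tm =
  ntapes :: nat
  nsyms :: nat
  nstates :: nat
  delta :: "nat \<Rightarrow> nat list \<Rightarrow> nat \<times> (nat \<times> dir) list"

definition wf_tm :: "tm \<Rightarrow> bool" where
  "wf_tm M \<longleftrightarrow> 1 \<le> ntapes M \<and> 3 \<le> nsyms M \<and>
    (\<forall>q < nstates M. \<forall>ss. length ss = ntapes M \<and> set ss \<subseteq> {..<nsyms M} \<longrightarrow>
      (case delta M q ss of (q', as) \<Rightarrow>
        q' \<le> nstates M \<and> length as = ntapes M \<and> (\<forall>(s, d) \<in> set as. s < nsyms M)))"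

text \<open>Tapes are infinite in both directions; a tape is its contents with the head position.\<close>

type_synonym tape = "(int \<Rightarrow> nat) \<times> int"
type_synonym config = "nat \<times> tape list"

fun scan :: "tape \<Rightarrow> nat" where
  "scan (c, h) = c h"

fun move :: "dir \<Rightarrow> int \<Rightarrow> int" where
  "move MoveL h = h - 1"
| "move Stay h = h"
| "move MoveR h = h + 1"

fun act :: "nat \<times> dir \<Rightarrow> tape \<Rightarrow> tape" where
  "act (s, d) (c, h) = (c(h := s), move d h)"

fun step :: "tm \<Rightarrow> config \<Rightarrow> config" where
  "step M (q, ts) =
    (if q < nstates M
     then (case delta M q (map scan ts) of (q', as) \<Rightarrow> (q', map2 act as ts))
     else (q, ts))"

text \<open>Binary representation, most significant digit first, as a word over the symbols
  \<open>1\<close> and \<open>2\<close>; the number \<open>0\<close> is represented by the empty word.\<close>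

fun bin :: "nat \<Rightarrow> nat list" where
  "bin n = (if n = 0 then [] else bin (n div 2) @ [n mod 2 + 1])"

declare bin.simps [simp del]

definition tape_word :: "nat list \<Rightarrow> int \<Rightarrow> nat" where
  "tape_word w j = (if 0 \<le> j \<and> j < int (length w) then w ! nat j else 0)"

text \<open>The input is on the first tape, the output is read off the last one; on a one-tape
  machine these coincide.\<close>

definition init :: "tm \<Rightarrow> nat \<Rightarrow> config" where
  "init M x = (0, (tape_word (bin x), 0) # replicate (ntapes M - 1) (\<lambda>_. 0, 0))"

definition run :: "tm \<Rightarrow> nat \<Rightarrow> nat \<Rightarrow> config" where
  "run M x t = (step M ^^ t) (init M x)"

definition halted_at :: "tm \<Rightarrow> nat \<Rightarrow> nat \<Rightarrow> bool" where
  "halted_at M x t \<longleftrightarrow> fst (run M x t) = nstates M"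

definition halts :: "tm \<Rightarrow> nat \<Rightarrow> bool" where
  "halts M x \<longleftrightarrow> (\<exists>t. halted_at M x t)"

definition run_time :: "tm \<Rightarrow> nat \<Rightarrow> nat" where
  "run_time M x = (LEAST t. halted_at M x t)"

definition outputs :: "tm \<Rightarrow> nat \<Rightarrow> nat \<Rightarrow> bool" where
  "outputs M x m \<longleftrightarrow>
    halts M x \<and> fst (last (snd (run M x (run_time M x)))) = tape_word (bin m)"

text \<open>Halting is required on every input: \<^const>\<open>run_time\<close> carries no information about
  inputs on which the machine diverges.\<close>

definition poly_time :: "tm \<Rightarrow> bool" where
  "poly_time M \<longleftrightarrow> (\<forall>x. halts M x) \<and>
    (\<exists>c::nat. (\<lambda>x. real (run_time M x)) \<in> O(\<lambda>x. log 2 (real x) ^ c))"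

end

theory Submission
  imports Defs "HOL-Real_Asymp.Real_Asymp"
begin

text \<open>
  The number \<open>m\<close> depends only on the bit length \<open>L\<close> of \<open>x\<close>: it suffices that \<open>m\<close> also has
  exactly \<open>L\<close> bits, for then \<open>x\<close> and \<open>m\<close> both lie in \<open>[2 ^ (L - 1), 2 ^ L)\<close>. Run through the
  primes \<open>p\<close> in increasing order with an accumulator \<open>a = 1\<close>. If \<open>p a\<close> has at least \<open>L\<close> bits,
  output it; otherwise, if \<open>p\<^sup>2 a\<close> has fewer than \<open>L\<close> bits, replace \<open>a\<close> by \<open>p a\<close>. The test on
  \<open>p\<^sup>2 a\<close> leaves room for one more prime: \<open>a\<close> ends up as the product of all primes below some
  \<open>y\<close> with \<open>a y\<^sup>2 \<ge> 2 ^ (L - 1)\<close>, so the last prime \<open>q\<close> is \<open>O(y\<^sup>2)\<close>. That the output has no more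
  than \<open>L\<close> bits is Bertrand's postulate for large numbers, and \<open>q\<close> is polynomial in \<open>L\<close> by a weak
  form of Chebyshev's lower bound for the number of primes.

  Since \<open>a \<le> 4 ^ y\<close>, the output is divisible by all primes below \<open>(L - 1) / 4\<close>, hence
  \<open>\<phi>(m) / m = O(1 / log L)\<close> because the product of \<open>1 / (1 - 1 / p)\<close> over \<open>p < y\<close> dominates
  the harmonic sum. Conversely \<open>m\<close> has at most \<open>L\<close> prime factors, so \<open>\<phi>(m) / m\<close> is, up to a
  constant, at least the product of \<open>1 - 1 / p\<close> over \<open>p \<le> L\<close>. This is bounded below by comparing
  \<open>1 + 1 / p\<close> with \<open>1 + p powr (- s)\<close> for \<open>s = 1 + 1 / ln L\<close>, whose product is at most
  \<open>\<zeta>(s) \<le> 1 + ln L\<close>.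
\<close>

section \<open>While programs on Turing machines\<close>

type_synonym tapes = "nat \<Rightarrow> tape"

definition scans :: "tapes \<Rightarrow> nat \<Rightarrow> nat" where
  "scans s i = scan (s i)"

definition shift :: "dir \<Rightarrow> tape \<Rightarrow> tape" where
  "shift d u = (fst u, move d (snd u))"

definition put :: "nat \<Rightarrow> tape \<Rightarrow> tape" where
  "put v u = ((fst u)(snd u := v), snd u)"

text \<open>A guard lists pairs of a tape and a symbol; it holds if one of these tapes does
  \<^emph>\<open>not\<close> scan its symbol.\<close>

type_synonym guard = "(nat \<times> nat) list"

definition holds :: "guard \<Rightarrow> (nat \<Rightarrow> nat) \<Rightarrow> bool" where
  "holds b \<sigma> \<longleftrightarrow> (\<exists>(i, v) \<in> set b. \<sigma> i \<noteq> v)"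

datatype com =
    Move nat dir
  | Write nat nat
  | Seq com com  (infixr \<open>;;\<close> 60)
  | Cond guard com com
  | While guard com

text \<open>The number is the exact count of machine steps of the compiled code: evaluating a guard
  costs one step of its own, sequencing costs none.\<close>

inductive exec :: "com \<Rightarrow> tapes \<Rightarrow> nat \<Rightarrow> tapes \<Rightarrow> bool" where
  Move: "exec (Move i d) s 1 (s(i := shift d (s i)))"
| Write: "exec (Write i v) s 1 (s(i := put v (s i)))"
| Seq: "exec c s t s' \<Longrightarrow> exec c' s' t' s'' \<Longrightarrow> exec (c ;; c') s (t + t') s''"
| CondT: "holds b (scans s) \<Longrightarrow> exec c s t s' \<Longrightarrow> exec (Cond b c c') s (Suc t) s'"
| CondF: "\<not> holds b (scans s) \<Longrightarrow> exec c' s t s' \<Longrightarrow> exec (Cond b c c') s (Suc t) s'"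
| WhileF: "\<not> holds b (scans s) \<Longrightarrow> exec (While b c) s 1 s"
| WhileT: "holds b (scans s) \<Longrightarrow> exec c s t s' \<Longrightarrow> exec (While b c) s' t' s'' \<Longrightarrow>
    exec (While b c) s (Suc (t + t')) s''"

fun len :: "com \<Rightarrow> nat" where
  "len (Move i d) = 1"
| "len (Write i v) = 1"
| "len (c ;; c') = len c + len c'"
| "len (Cond b c c') = Suc (len c + len c')"
| "len (While b c) = Suc (len c)"

text \<open>\<open>code c a e\<close> is the transition function of \<open>c\<close> placed at the states
  \<open>a, \<dots>, a + len c - 1\<close>, with \<open>e\<close> as the state to continue with.\<close>

fun code :: "com \<Rightarrow> nat \<Rightarrow> nat \<Rightarrow> nat \<Rightarrow> (nat \<Rightarrow> nat) \<Rightarrow> nat \<times> (nat \<Rightarrow> nat \<times> dir)" where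
  "code (Move i d) a e q \<sigma> = (e, \<lambda>j. (\<sigma> j, if j = i then d else Stay))"
| "code (Write i v) a e q \<sigma> = (e, \<lambda>j. (if j = i then v else \<sigma> j, Stay))"
| "code (c ;; c') a e q \<sigma> =
    (if q < a + len c then code c a (a + len c) q \<sigma> else code c' (a + len c) e q \<sigma>)"
| "code (Cond b c c') a e q \<sigma> =
    (if q = a then (if holds b \<sigma> then Suc a else Suc (a + len c), \<lambda>j. (\<sigma> j, Stay))
     else if q < Suc (a + len c) then code c (Suc a) e q \<sigma>
     else code c' (Suc (a + len c)) e q \<sigma>)"
| "code (While b c) a e q \<sigma> =
    (if q = a then (if holds b \<sigma> then Suc a else e, \<lambda>j. (\<sigma> j, Stay))
     else code c (Suc a) a q \<sigma>)"

fun wf_com :: "nat \<Rightarrow> nat \<Rightarrow> com \<Rightarrow> bool" where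
  "wf_com k n (Move i d) \<longleftrightarrow> True"
| "wf_com k n (Write i v) \<longleftrightarrow> v < n"
| "wf_com k n (c ;; c') \<longleftrightarrow> wf_com k n c \<and> wf_com k n c'"
| "wf_com k n (Cond b c c') \<longleftrightarrow> (\<forall>(i, v)\<in>set b. i < k) \<and> wf_com k n c \<and> wf_com k n c'"
| "wf_com k n (While b c) \<longleftrightarrow> (\<forall>(i, v)\<in>set b. i < k) \<and> wf_com k n c"

section \<open>Correctness of compilation\<close>

lemma act_scan [simp]: "act (scan u, Stay) u = u"
  by (cases u) auto

lemma act_scans [simp]: "act (scans s i, Stay) (s i) = s i"
  by (simp add: scans_def)

lemma code_symbol_less:
  assumes "wf_com k n c" and "\<And>j. j < k \<Longrightarrow> \<sigma> j < n" and "i < k"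
  shows "fst (snd (code c a e q \<sigma>) i) < n"
  using assms by (induction c arbitrary: a e) auto

lemma code_state_le:
  assumes "a \<le> q" and "q < a + len c" and "a + len c \<le> N" and "e \<le> N"
  shows "fst (code c a e q \<sigma>) \<le> N"
  using assms
proof (induction c arbitrary: a e)
  case (Seq c c')
  then show ?case
    by (cases "q < a + len c") auto
next
  case (Cond b c c')
  then show ?case
    by (cases "q < Suc (a + len c)") (auto simp: Suc_le_eq)
qed (auto simp: Suc_le_eq)

lemma holds_cong:
  assumes "\<forall>(i, v)\<in>set b. i < k" and "\<And>i. i < k \<Longrightarrow> \<sigma> i = \<tau> i"
  shows "holds b \<sigma> = holds b \<tau>"
  unfolding holds_def using assms by (intro bex_cong) auto

text \<open>The machine feeds \<open>code\<close> the function \<open>(!) ss\<close>, whose values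
  beyond the list are unspecified. Since the guards of a well-formed program mention only tapes
  below \<open>k\<close>, it may be replaced by \<open>scans s\<close>.\<close>

lemma code_cong:
  assumes "wf_com k n c" and "\<And>i. i < k \<Longrightarrow> \<sigma> i = \<tau> i"
  shows "fst (code c a e q \<sigma>) = fst (code c a e q \<tau>) \<and>
    (\<forall>i<k. snd (code c a e q \<sigma>) i = snd (code c a e q \<tau>) i)"
  using assms
proof (induction c arbitrary: a e)
  case (Cond b c c')
  then show ?case using holds_cong[of b k \<sigma> \<tau>] by auto
next
  case (While b c)
  then show ?case using holds_cong[of b k \<sigma> \<tau>] by auto
qed auto

definition tm_of :: "nat \<Rightarrow> nat \<Rightarrow> com \<Rightarrow> tm" where
  "tm_of k n c = \<lparr>ntapes = k, nsyms = n, nstates = len c,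
     delta = (\<lambda>q ss. let (q', f) = code c 0 (len c) q ((!) ss) in (q', map f [0..<k]))\<rparr>"

lemma wf_tm_of:
  assumes "wf_com k n c" and "1 \<le> k" and "3 \<le> n"
  shows "wf_tm (tm_of k n c)"
  unfolding wf_tm_def
proof (intro conjI allI impI)
  fix q ss
  assume q: "q < nstates (tm_of k n c)"
    and ss: "length ss = ntapes (tm_of k n c) \<and> set ss \<subseteq> {..<nsyms (tm_of k n c)}"
  have "fst (code c 0 (len c) q ((!) ss)) \<le> len c"
    using q by (intro code_state_le) (auto simp: tm_of_def)
  moreover have "\<forall>i<k. fst (snd (code c 0 (len c) q ((!) ss)) i) < n"
    using ss by (auto simp: tm_of_def subset_iff intro!: code_symbol_less[OF assms(1)])
  ultimately show "case delta (tm_of k n c) q ss of (q', as) \<Rightarrow>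
      q' \<le> nstates (tm_of k n c) \<and> length as = ntapes (tm_of k n c) \<and>
      (\<forall>(s, d)\<in>set as. s < nsyms (tm_of k n c))"
    by (force simp: tm_of_def case_prod_beta)
qed (use assms in \<open>auto simp: tm_of_def\<close>)

definition config_of :: "nat \<Rightarrow> nat \<times> tapes \<Rightarrow> config" where
  "config_of k = (\<lambda>(q, s). (q, map s [0..<k]))"

lemma step_tm_of:
  assumes "wf_com k n c" and "q < len c"
  shows "step (tm_of k n c) (config_of k (q, s)) =
    (case code c 0 (len c) q (scans s) of
       (q', f) \<Rightarrow> config_of k (q', \<lambda>i. act (f i) (s i)))"
proof -
  have *: "fst (code c 0 (len c) q ((!) (map (scan \<circ> s) [0..<k]))) =
      fst (code c 0 (len c) q (scans s)) \<and>
      (\<forall>i<k. snd (code c 0 (len c) q ((!) (map (scan \<circ> s) [0..<k]))) i =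
        snd (code c 0 (len c) q (scans s)) i)"
    by (rule code_cong[OF assms(1)]) (auto simp: scans_def)
  show ?thesis using * assms(2)
    by (auto simp: config_of_def tm_of_def case_prod_beta Let_def intro!: nth_equalityI)
qed

text \<open>The hypothesis concerns only the states \<open>a, ..., a + len c - 1\<close> and leaves
  \<open>a\<close> and the exit \<open>e\<close> free, so every subprogram inherits it. The body of
  a loop starts at \<open>Suc a\<close> and has exit \<open>a\<close>, the state of the
  guard.\<close>

lemma exec_simulation:
  assumes "exec c s t s'"
    and "\<And>q s. a \<le> q \<Longrightarrow> q < a + len c \<Longrightarrow>
      step M (config_of k (q, s)) =
        (case code c a e q (scans s) of (q', f) \<Rightarrow> config_of k (q', \<lambda>i. act (f i) (s i)))"
  shows "(step M ^^ t) (config_of k (a, s)) = config_of k (e, s')"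
  using assms
proof (induction c s t s' arbitrary: a e rule: exec.induct)
  case (Move i d s)
  have "(\<lambda>j. act (scans s j, if j = i then d else Stay) (s j)) =
      s(i := shift d (s i))"
    by (rule ext, case_tac "s i") (auto simp: scans_def shift_def put_def)
  then show ?case using Move[of a s] by (simp del: fun_upd_apply)
next
  case (Write i v s)
  have "(\<lambda>j. act (if j = i then v else scans s j, Stay) (s j)) =
      s(i := put v (s i))"
    by (rule ext, case_tac "s i") (auto simp: scans_def shift_def put_def)
  then show ?case using Write[of a s] by (simp del: fun_upd_apply)
next
  case (Seq c s t s' c' t' s'')
  have "(step M ^^ t) (config_of k (a, s)) = config_of k (a + len c, s')"
  proof (rule Seq.IH(1))
    fix q u assume q: "a \<le> q" "q < a + len c"
    then have "a \<le> q" "q < a + len (c ;; c')"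
      by simp_all
    moreover have "code (c ;; c') a e q (scans u) = code c a (a + len c) q (scans u)"
      using q by simp
    ultimately show "step M (config_of k (q, u)) = (case code c a (a + len c) q (scans u) of
      (q', f) \<Rightarrow> config_of k (q', \<lambda>i. act (f i) (u i)))"
      using Seq.prems[of q u] by (simp only:)
  qed
  moreover have "(step M ^^ t') (config_of k (a + len c, s')) = config_of k (e, s'')"
  proof (rule Seq.IH(2))
    fix q u assume q: "a + len c \<le> q" "q < a + len c + len c'"
    then have "a \<le> q" "q < a + len (c ;; c')"
      by simp_all
    moreover have "code (c ;; c') a e q (scans u) = code c' (a + len c) e q (scans u)"
      using q by simp
    ultimately show "step M (config_of k (q, u)) = (case code c' (a + len c) e q (scans u) of
      (q', f) \<Rightarrow> config_of k (q', \<lambda>i. act (f i) (u i)))"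
      using Seq.prems[of q u] by (simp only:)
  qed
  ultimately show ?case by (simp only: funpow_add add.commute[of t t'] comp_def)
next
  case (CondT b s c t s' c')
  have "(step M ^^ t) (config_of k (Suc a, s)) = config_of k (e, s')"
  proof (rule CondT.IH)
    fix q u assume q: "Suc a \<le> q" "q < Suc a + len c"
    then have "a \<le> q" "q < a + len (Cond b c c')"
      by simp_all
    moreover have "code (Cond b c c') a e q (scans u) = code c (Suc a) e q (scans u)"
      using q by simp
    ultimately show "step M (config_of k (q, u)) = (case code c (Suc a) e q (scans u) of
      (q', f) \<Rightarrow> config_of k (q', \<lambda>i. act (f i) (u i)))"
      using CondT.prems[of q u] by (simp only:)
  qed
  moreover have "step M (config_of k (a, s)) = config_of k (Suc a, s)"
    using CondT.prems[of a s] CondT.hyps by simp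
  ultimately show ?case
    by (simp only: funpow_Suc_right comp_def)
next
  case (CondF b s c' t s' c)
  have "(step M ^^ t) (config_of k (Suc (a + len c), s)) = config_of k (e, s')"
  proof (rule CondF.IH)
    fix q u assume q: "Suc (a + len c) \<le> q" "q < Suc (a + len c) + len c'"
    then have "a \<le> q" "q < a + len (Cond b c c')"
      by simp_all
    moreover have "code (Cond b c c') a e q (scans u) = code c' (Suc (a + len c)) e q (scans u)"
      using q by simp
    ultimately show "step M (config_of k (q, u)) = (case code c' (Suc (a + len c)) e q (scans u) of
      (q', f) \<Rightarrow> config_of k (q', \<lambda>i. act (f i) (u i)))"
      using CondF.prems[of q u] by (simp only:)
  qed
  moreover have "step M (config_of k (a, s)) = config_of k (Suc (a + len c), s)"
    using CondF.prems[of a s] CondF.hyps by simp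
  ultimately show ?case
    by (simp only: funpow_Suc_right comp_def)
next
  case (WhileF b s c)
  then show ?case using WhileF.prems[of a s] by simp
next
  case (WhileT b s c t s' t' s'')
  have "(step M ^^ t) (config_of k (Suc a, s)) = config_of k (a, s')"
  proof (rule WhileT.IH(1))
    fix q u assume q: "Suc a \<le> q" "q < Suc a + len c"
    then have "a \<le> q" "q < a + len (While b c)"
      by simp_all
    moreover have "code (While b c) a e q (scans u) = code c (Suc a) a q (scans u)"
      using q by simp
    ultimately show "step M (config_of k (q, u)) = (case code c (Suc a) a q (scans u) of
      (q', f) \<Rightarrow> config_of k (q', \<lambda>i. act (f i) (u i)))"
      using WhileT.prems[of q u] by (simp only:)
  qed
  moreover have "(step M ^^ t') (config_of k (a, s')) = config_of k (e, s'')"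
    by (rule WhileT.IH(2)[OF WhileT.prems])
  moreover have "step M (config_of k (a, s)) = config_of k (Suc a, s)"
    using WhileT.prems[of a s] WhileT.hyps by simp
  ultimately show ?case
    by (simp only: funpow_Suc_right add.commute[of t t'] funpow_add comp_def)
qed

definition start :: "nat \<Rightarrow> tapes" where
  "start x = (\<lambda>_. (\<lambda>_. 0, 0))(0 := (tape_word (bin x), 0))"

lemma exec_run:
  assumes "wf_com k n c" and "1 \<le> k" and "exec c (start x) t s'"
  shows "run (tm_of k n c) x t = config_of k (len c, s')"
proof -
  have "init (tm_of k n c) x = config_of k (0, start x)"
  proof -
    obtain j where "k = Suc j" using assms(2) by (cases k) auto
    moreover have "map (start x) [0..<Suc j] = start x 0 # map (start x \<circ> Suc) [0..<j]"
      by (simp only: map_upt_Suc comp_def)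
    moreover have "map (start x \<circ> Suc) [0..<j] = replicate j (\<lambda>_. 0, 0)"
      by (auto simp: start_def intro: nth_equalityI)
    ultimately show ?thesis
      by (simp add: init_def config_of_def tm_of_def start_def del: upt_Suc)
  qed
  moreover have "(step (tm_of k n c) ^^ t) (config_of k (0, start x)) = config_of k (len c, s')"
    by (rule exec_simulation[OF assms(3)]) (rule step_tm_of[OF assms(1)], simp)
  ultimately show ?thesis
    by (simp add: run_def)
qed

lemma run_halted:
  assumes "halted_at M x t" and "t \<le> t'"
  shows "run M x t' = run M x t"
  using assms(2)
proof (induction rule: dec_induct)
  case (step u)
  then show ?case using assms(1)
    by (cases "run M x t") (auto simp: run_def halted_at_def)
qed simp

text \<open>\<open>run_time\<close> is the least halting time and so at most \<open>t\<close>; as a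
  halted configuration no longer changes, the tapes at both times agree.\<close>

lemma exec_outcome:
  assumes "wf_com (Suc k) n c" and "exec c (start x) t s'"
  shows "halts (tm_of (Suc k) n c) x"
    and "run_time (tm_of (Suc k) n c) x \<le> t"
    and "fst (last (snd (run (tm_of (Suc k) n c) x (run_time (tm_of (Suc k) n c) x)))) = fst (s' k)"
proof -
  let ?M = "tm_of (Suc k) n c"
  have r: "run ?M x t = config_of (Suc k) (len c, s')"
    by (rule exec_run[OF assms(1) _ assms(2)]) simp
  then have h: "halted_at ?M x t"
    by (simp add: halted_at_def config_of_def tm_of_def)
  then show "halts ?M x" by (auto simp: halts_def)
  show le: "run_time ?M x \<le> t"
    unfolding run_time_def using h by (rule Least_le)
  have "halted_at ?M x (run_time ?M x)"
    unfolding run_time_def using h by (rule LeastI)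
  then have "run ?M x (run_time ?M x) = run ?M x t"
    using run_halted le by metis
  then show "fst (last (snd (run ?M x (run_time ?M x)))) = fst (s' k)"
    using r by (simp add: config_of_def)
qed

text \<open>From here on only upper bounds for the time are kept, so that costs can be rounded up to
  convenient expressions.\<close>

definition runs :: "com \<Rightarrow> tapes \<Rightarrow> nat \<Rightarrow> tapes \<Rightarrow> bool" where
  "runs c s T s' \<longleftrightarrow> (\<exists>t\<le>T. exec c s t s')"

lemma runs_mono: "runs c s T s' \<Longrightarrow> T \<le> T' \<Longrightarrow> runs c s T' s'"
  by (auto simp: runs_def intro: le_trans)

lemma runs_Move: "s' = s(i := shift d (s i)) \<Longrightarrow> 1 \<le> T \<Longrightarrow> runs (Move i d) s T s'"
  unfolding runs_def using exec.Move by blast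

lemma runs_Write:
  "s' = s(i := put v (s i)) \<Longrightarrow> 1 \<le> T \<Longrightarrow> runs (Write i v) s T s'"
  unfolding runs_def using exec.Write by blast

lemmas runs_Move1 = runs_Move[OF _ order_refl]

lemma runs_Seq:
  "runs c s T s' \<Longrightarrow> runs c' s' T' s'' \<Longrightarrow> T + T' \<le> U \<Longrightarrow> runs (c ;; c') s U s''"
  unfolding runs_def by (elim exE conjE, rule exI, rule conjI[rotated], erule (1) exec.Seq) linarith

lemma runs_Move_Seq:
  "runs c (s(i := shift d (s i))) T s' \<Longrightarrow> Suc T \<le> U \<Longrightarrow> runs (Move i d ;; c) s U s'"
  by (rule runs_Seq[OF runs_Move[OF refl order_refl]]) auto

lemma runs_Write_Seq:
  "runs c (s(i := put v (s i))) T s' \<Longrightarrow> Suc T \<le> U \<Longrightarrow> runs (Write i v ;; c) s U s'"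
  by (rule runs_Seq[OF runs_Write[OF refl order_refl]]) auto

lemma runs_Cond:
  assumes "holds b (scans s) \<Longrightarrow> runs c s T s'" and "\<not> holds b (scans s) \<Longrightarrow> runs c' s T s'"
    and "Suc T \<le> U"
  shows "runs (Cond b c c') s U s'"
proof (cases "holds b (scans s)")
  case True
  then obtain t where "t \<le> T" "exec c s t s'" using assms(1) by (auto simp: runs_def)
  then show ?thesis using exec.CondT[OF True] assms(3) by (auto simp: runs_def intro!: exI[of _
      "Suc t"])
next
  case False
  then obtain t where "t \<le> T" "exec c' s t s'" using assms(2) by (auto simp: runs_def)
  then show ?thesis using exec.CondF[OF False] assms(3) by (auto simp: runs_def intro!: exI[of _
      "Suc t"])
qed

text \<open>Instead of an invariant, the whole sequence \<open>f 0, ..., f n\<close> of states at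
  the loop head is supplied, which yields correctness, termination and the time bound together. Each
  round costs its body plus one test; the failing test adds one more.\<close>

lemma runs_While:
  assumes "\<And>j. j < n \<Longrightarrow> holds b (scans (f j)) \<and> runs c (f j) T (f (Suc j))"
    and "\<not> holds b (scans (f n))" and "s = f 0" and "s' = f n" and "Suc (n * Suc T) \<le> U"
  shows "runs (While b c) s U s'"
proof -
  have "runs (While b c) (f j) (Suc ((n - j) * Suc T)) (f n)" if "j \<le> n" for j
    using that
  proof (induction rule: inc_induct)
    case base
    show ?case using assms(2) WhileF by (auto simp: runs_def)
  next
    case (step j)
    then obtain t t' where "exec c (f j) t (f (Suc j))" "t \<le> T"
      "exec (While b c) (f (Suc j)) t' (f n)" "t' \<le> Suc ((n - Suc j) * Suc T)"
      using assms(1)[of j] by (auto simp: runs_def)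
    moreover have "(n - j) * Suc T = Suc T + (n - Suc j) * Suc T"
      using step.hyps by (metis Suc_diff_Suc mult_Suc)
    ultimately show ?case
      using WhileT[of b "f j" c t "f (Suc j)" t' "f n"] assms(1)[of j] step.hyps
      unfolding runs_def by (intro exI[of _ "Suc (t + t')"]) auto
  qed
  from this[of 0] show ?thesis
    using assms(3-5) by (auto intro: runs_mono)
qed

section \<open>Numbers on tapes\<close>

declare scans_def [simp]

lemma holds_Nil [simp]: "\<not> holds [] \<sigma>"
  and holds_Cons [simp]: "holds ((i, v) # b) \<sigma> \<longleftrightarrow> \<sigma> i \<noteq> v \<or> holds b \<sigma>"
  by (auto simp: holds_def)

section \<open>Binary digits and their layout on tapes\<close>

definition bitlen :: "nat \<Rightarrow> nat" where
  "bitlen n = length (bin n)"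

lemma bitlen_0 [simp]: "bitlen 0 = 0"
  by (simp add: bitlen_def bin.simps)

lemma bitlen_le_iff: "bitlen n \<le> k \<longleftrightarrow> n < 2 ^ k"
proof (induction k arbitrary: n)
  case 0
  show ?case by (subst bitlen_def, subst bin.simps) auto
next
  case (Suc k)
  show ?case
  proof (cases "n = 0")
    case False
    then have "bitlen n = Suc (bitlen (n div 2))"
      by (subst bitlen_def, subst bin.simps) (simp add: bitlen_def)
    then show ?thesis using Suc.IH[of "n div 2"] by auto
  qed simp
qed

lemma less_bitlen_iff: "k < bitlen n \<longleftrightarrow> 2 ^ k \<le> n"
  using bitlen_le_iff[of n k] by linarith

lemma bitlen_mono: "m \<le> n \<Longrightarrow> bitlen m \<le> bitlen n"
  using bitlen_le_iff[of n "bitlen n"] bitlen_le_iff[of m "bitlen n"] by simp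

text \<open>The tape symbol for the binary digit of weight \<open>2 ^ k\<close>; leading zeros are blank.\<close>

definition digit :: "nat \<Rightarrow> nat \<Rightarrow> nat" where
  "digit n k = (if 2 ^ k \<le> n then n div 2 ^ k mod 2 + 1 else 0)"

lemma digit_eq_0_iff: "digit n k = 0 \<longleftrightarrow> bitlen n \<le> k"
  by (auto simp: digit_def bitlen_le_iff)

lemma digit_0 [simp]: "digit 0 = (\<lambda>_. 0)"
  by (auto simp: digit_def)

lemma digit_1: "digit (Suc 0) = (\<lambda>_. 0)(0 := 2)"
proof
  show "digit (Suc 0) k = ((\<lambda>_. 0)(0 := 2)) k" for k
    using less_exp[of k] by (cases k) (auto simp: digit_def)
qed

lemma nth_bin: "k < bitlen n \<Longrightarrow> bin n ! (bitlen n - Suc k) = digit n k"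
proof (induction k arbitrary: n)
  case 0
  then have "n \<noteq> 0" by (cases "n = 0") auto
  then show ?case
    by (simp add: bitlen_def bin.simps[of n] digit_def nth_append)
next
  case (Suc k)
  then have "n \<noteq> 0" by (cases "n = 0") auto
  then have bin: "bin n = bin (n div 2) @ [n mod 2 + 1]"
    by (simp add: bin.simps[of n])
  then have "bitlen n = Suc (bitlen (n div 2))"
    by (simp add: bitlen_def)
  with Suc have "bin n ! (bitlen n - Suc (Suc k)) = digit (n div 2) k"
    using Suc.IH[of "n div 2"] bin by (auto simp: nth_append bitlen_def)
  also have "\<dots> = digit n (Suc k)"
  proof -
    have "2 ^ k \<le> n div 2 \<longleftrightarrow> 2 ^ Suc k \<le> n" by auto
    then show ?thesis by (simp add: digit_def div_mult2_eq)
  qed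
  finally show ?case .
qed

text \<open>The cells left of position \<open>L\<close> hold \<open>h 0, h 1, \<dots>\<close> from right to left, and the head is on
  \<open>h k\<close>. With \<open>L\<close> the bit length of the input, a number with exactly \<open>L\<close> digits
  starts at position \<open>0\<close>, as required of the output.\<close>

definition dtape :: "nat \<Rightarrow> (nat \<Rightarrow> nat) \<Rightarrow> int \<Rightarrow> tape" where
  "dtape L h k = (\<lambda>j. if j < int L then h (nat (int L - 1 - j)) else 0, int L - 1 - k)"

lemma scan_dtape [simp]: "scan (dtape L h k) = (if k < 0 then 0 else h (nat k))"
  by (simp add: dtape_def)

lemma move_dtape [simp]:
  "shift MoveL (dtape L h k) = dtape L h (k + 1)"
  "shift MoveR (dtape L h k) = dtape L h (k - 1)"
  "shift Stay (dtape L h k) = dtape L h k"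
  by (auto simp: dtape_def shift_def)

lemma write_dtape [simp]:
  "0 \<le> k \<Longrightarrow> put v (dtape L h k) =
    dtape L (h(nat k := v)) k"
  by (auto simp: dtape_def put_def fun_eq_iff)

text \<open>Words begin with the leading digit whereas \<open>digit\<close> counts from the units;
  the reversal is \<open>nth_bin\<close>. Left of cell \<open>0\<close> both sides are blank because
  \<open>digit n\<close> is \<open>0\<close> from \<open>bitlen n\<close> on.\<close>

lemma tape_word_bin: "tape_word (bin n) = fst (dtape (bitlen n) (digit n) k)"
proof
  fix j
  show "tape_word (bin n) j = fst (dtape (bitlen n) (digit n) k) j"
  proof (cases "0 \<le> j \<and> j < int (bitlen n)")
    case True
    then have "bitlen n - Suc (nat (int (bitlen n) - 1 - j)) = nat j" "nat (int (bitlen n) - 1 -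
        j) < bitlen n"
      by linarith+
    with True nth_bin[of "nat (int (bitlen n) - 1 - j)" n] show ?thesis
      by (simp add: tape_word_def dtape_def bitlen_def[symmetric])
  next
    case False
    moreover have "digit n (nat (int (bitlen n) - 1 - j)) = 0" if "j < 0"
      using that by (simp add: digit_eq_0_iff)
    ultimately show ?thesis
      by (auto simp: tape_word_def dtape_def bitlen_def[symmetric])
  qed
qed

text \<open>A counter holds its value in the position of the head; a register \<open>n\<close> has the
  symbol \<open>2\<close> at position \<open>n\<close>, so that it can be read by moving the head from \<open>0\<close> to \<open>n\<close>.\<close>

definition ctr :: "nat \<Rightarrow> tape" where
  "ctr n = (\<lambda>j. if j = 0 then 1 else 0, int n)"

definition reg :: "nat \<Rightarrow> nat \<Rightarrow> tape" where
  "reg n k = (\<lambda>j. if j = 0 then 1 else if j = int n then 2 else 0, int k)"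

lemma scan_ctr [simp]: "scan (ctr n) = (if n = 0 then 1 else 0)"
  by (simp add: ctr_def)

lemma move_ctr [simp]:
  "shift MoveR (ctr n) = ctr (Suc n)"
  "0 < n \<Longrightarrow> shift MoveL (ctr n) = ctr (n - 1)"
  by (auto simp: ctr_def shift_def)

lemma scan_reg [simp]: "scan (reg n k) = (if k = 0 then 1 else if k = n then 2 else 0)"
  by (simp add: reg_def)

lemma move_reg [simp]:
  "shift MoveR (reg n k) = reg n (Suc k)"
  "0 < k \<Longrightarrow> shift MoveL (reg n k) = reg n (k - 1)"
  by (auto simp: reg_def shift_def)

lemma fun_upd_eq_iff: "s(i := u) = t \<longleftrightarrow> u = t i \<and> (\<forall>j. j \<noteq> i \<longrightarrow> s j = t j)"
  by (auto simp: fun_eq_iff)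


abbreviation rewind :: "nat \<Rightarrow> com" where
  "rewind i \<equiv> While [(i, 1)] (Move i MoveL)"

abbreviation forward :: "nat \<Rightarrow> com" where
  "forward i \<equiv> While [(i, 2)] (Move i MoveR)"

lemma runs_rewind:
  assumes "s i = reg n k" and "2 * k + 1 \<le> T"
  shows "runs (rewind i) s T (s(i := reg n 0))"
proof (rule runs_While[where f = "\<lambda>j. s(i := reg n (k - j))" and n = k and T = 1])
  fix j assume "j < k"
  then show "holds [(i, 1)] (scans (s(i := reg n (k - j)))) \<and>
      runs (Move i MoveL) (s(i := reg n (k - j))) 1 (s(i := reg n (k - Suc j)))"
    by (intro conjI runs_Move) simp_all
qed (use assms in \<open>auto simp: fun_eq_iff\<close>)

lemma runs_forward:
  assumes "s i = reg n k" and "k \<le> n" and "0 < n" and "2 * (n - k) + 1 \<le> T"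
  shows "runs (forward i) s T (s(i := reg n n))"
proof (rule runs_While[where f = "\<lambda>j. s(i := reg n (k + j))" and n = "n - k" and T = 1])
  fix j assume "j < n - k"
  then show "holds [(i, 2)] (scans (s(i := reg n (k + j)))) \<and>
      runs (Move i MoveR) (s(i := reg n (k + j))) 1 (s(i := reg n (k + Suc j)))"
    by (intro conjI runs_Move) simp_all
qed (use assms in \<open>auto simp: fun_eq_iff\<close>)

section \<open>Multiplication of a binary number by a register\<close>

definition add_reg :: com where
  "add_reg = While [(1, 2)] (Move 1 MoveR ;; Move 3 MoveR) ;; rewind 1"

lemma runs_add_reg:
  assumes "s 1 = reg p 0" and "s 3 = ctr c" and "0 < p" and "5 * p + 2 \<le> T"
  shows "runs add_reg s T (s(3 := ctr (c + p)))"
  unfolding add_reg_def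
proof (rule runs_Seq)
  show "runs (While [(1, 2)] (Move 1 MoveR ;; Move 3 MoveR)) s (Suc (p * Suc 2))
      (s(1 := reg p p, 3 := ctr (c + p)))"
  proof (rule runs_While[where f = "\<lambda>j. s(1 := reg p j, 3 := ctr (c + j))" and n = p and T = 2])
    fix j assume "j < p"
    then show "holds [(1, 2)] (scans (s(1 := reg p j, 3 := ctr (c + j)))) \<and>
        runs (Move 1 MoveR ;; Move 3 MoveR) (s(1 := reg p j, 3 := ctr (c + j))) 2
          (s(1 := reg p (Suc j), 3 := ctr (c + Suc j)))"
      by (auto intro!: runs_Move_Seq runs_Move1 simp: fun_eq_iff)
  qed (use assms in \<open>auto simp: fun_eq_iff\<close>)
  have "runs (rewind 1) (s(1 := reg p p, 3 := ctr (c + p))) (2 * p + 1)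
      ((s(1 := reg p p, 3 := ctr (c + p)))(1 := reg p 0))"
    by (rule runs_rewind[where k = p]) simp_all
  also have "(s(1 := reg p p, 3 := ctr (c + p)))(1 := reg p 0) = s(3 := ctr (c + p))"
    using assms by (auto simp: fun_eq_iff)
  finally show "runs (rewind 1) (s(1 := reg p p, 3 := ctr (c + p))) (2 * p + 1)
    (s(3 := ctr (c + p)))" .
qed (use assms in simp)

text \<open>Splits off the lowest bit of the carry. Symbol \<open>1\<close> is the binary digit
  zero, so the carry is first taken to be even; if it runs out in the middle of a pair, the digit is
  corrected to \<open>2\<close>.\<close>

definition halve :: "nat \<Rightarrow> com" where
  "halve i = Write i 1 ;;
    While [(3, 1)] (Move 3 MoveL ;; Cond [(3, 1)] (Move 3 MoveL ;; Move 4 MoveR) (Write i 2))"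

lemma runs_halve:
  assumes "4 < i" and "s 3 = ctr c" and "s 4 = ctr 0" and "s i = dtape L h k" and "0 \<le> k"
    and "3 * c + 5 \<le> T"
  shows "runs (halve i) s T
    (s(3 := ctr 0, 4 := ctr (c div 2), i := dtape L (h(nat k := c mod 2 + 1)) k))"
  unfolding halve_def
proof (rule runs_Write_Seq)
  show "Suc (Suc ((c + 1) div 2 * Suc 4)) \<le> T"
    using assms(6) by simp
  \<comment> \<open>For odd \<open>c\<close> the last round removes a single unit. The truncated
    subtraction, the \<open>min\<close> and the test \<open>c < 2 * j\<close> make the formula cover
    that round too.\<close>
  let ?f = "\<lambda>j. s(3 := ctr (c - 2 * j), 4 := ctr (min j (c div 2)),
    i := dtape L (h(nat k := if c < 2 * j then 2 else 1)) k)"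
  let ?c = "Move 3 MoveL ;; Cond [(3, 1)] (Move 3 MoveL ;; Move 4 MoveR) (Write i 2)"
  show "runs (While [(3, 1)] ?c) (s(i := put 1 (s i))) (Suc ((c + 1) div 2 * Suc 4))
      (s(3 := ctr 0, 4 := ctr (c div 2), i := dtape L (h(nat k := c mod 2 + 1)) k))"
  proof (rule runs_While[where f = ?f and n = "(c + 1) div 2" and T = 4])
    fix j assume j: "j < (c + 1) div 2"
    then have "2 * j < c" by auto
    have "runs ?c (?f j) 4 (?f (Suc j))"
    proof (cases "c = Suc (2 * j)")
      case True
      show ?thesis
        by (rule runs_Move_Seq, rule runs_Cond[where T = 2 and U = 3])
          (use assms True in \<open>auto intro!: runs_Write simp: fun_eq_iff\<close>)
    next
      case False
      with \<open>2 * j < c\<close> have "Suc j \<le> c div 2" and "\<not> c \<le> Suc (2 * j)" by linarith+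
      show ?thesis
        by (rule runs_Move_Seq, rule runs_Cond[where T = 2 and U = 3])
          (use assms \<open>Suc j \<le> c div 2\<close> \<open>\<not> c \<le> Suc (2 * j)\<close> in \<open>auto intro!: runs_Move_Seq
              runs_Move1 simp: fun_eq_iff\<close>)
    qed
    then show "holds [(3, 1)] (scans (?f j)) \<and> runs ?c (?f j) 4 (?f (Suc j))"
      using \<open>2 * j < c\<close> assms(1) by simp
  next
    have "(if c < 2 * ((c + 1) div 2) then 2 else 1) = c mod 2 + 1" by presburger
    moreover have "c - 2 * ((c + 1) div 2) = 0" "min ((c + 1) div 2) (c div 2) = c div 2" by auto
    ultimately show "s(3 := ctr 0, 4 := ctr (c div 2), i := dtape L (h(nat k := c mod 2 + 1)) k)
        = ?f ((c + 1) div 2)"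
      by (simp only:)
  qed (use assms in \<open>auto simp: fun_eq_iff\<close>)
qed

definition carry_back :: com where
  "carry_back = While [(4, 1)] (Move 4 MoveL ;; Move 3 MoveR)"

lemma runs_carry_back:
  assumes "s 3 = ctr 0" and "s 4 = ctr c" and "3 * c + 1 \<le> T"
  shows "runs carry_back s T (s(3 := ctr c, 4 := ctr 0))"
  unfolding carry_back_def
proof (rule runs_While[where f = "\<lambda>j. s(3 := ctr j, 4 := ctr (c - j))" and n = c and T = 2])
  fix j assume "j < c"
  then show "holds [(4, 1)] (scans (s(3 := ctr j, 4 := ctr (c - j)))) \<and>
      runs (Move 4 MoveL ;; Move 3 MoveR) (s(3 := ctr j, 4 := ctr (c - j))) 2
        (s(3 := ctr (Suc j), 4 := ctr (c - Suc j)))"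
    by (auto intro!: runs_Move_Seq runs_Move1 simp: fun_eq_iff)
qed (use assms in \<open>auto simp: fun_eq_iff\<close>)

definition mult_digit :: "nat \<Rightarrow> com" where
  "mult_digit i = Cond [(i, 2)] (Move 0 Stay) add_reg ;; halve i ;; carry_back ;;
    Move i MoveL ;; Move 0 MoveL"

definition mult_reg :: "nat \<Rightarrow> com" where
  "mult_reg i = While [(i, 0), (3, 1)] (mult_digit i)"

lemma runs_mult_digit:
  assumes "4 < i" and "s 0 = dtape L h0 k" and "s 1 = reg p 0" and "s 3 = ctr c" and "s 4 = ctr 0"
    and "s i = dtape L h k" and "0 \<le> k" and "0 < p" and "c < p"
    and c': "c' = (if h (nat k) = 2 then c + p else c)"
    and "20 * p + 12 \<le> T"
  shows "runs (mult_digit i) s T (s(0 := dtape L h0 (k + 1),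
    3 := ctr (c' div 2), i := dtape L (h(nat k := c' mod 2 + 1)) (k + 1)))"
  unfolding mult_digit_def
proof (rule runs_Seq)
  have "c' < 2 * p" using assms(9) c' by auto
  let ?s = "s(3 := ctr c')"
  show "runs (Cond [(i, 2)] (Move 0 Stay) add_reg) s (5 * p + 3) ?s"
    by (rule runs_Cond[where T = "5 * p + 2"])
      (use assms(2-9) c' in \<open>auto intro!: runs_Move runs_add_reg simp: fun_eq_iff\<close>)
  let ?u = "?s(3 := ctr 0, 4 := ctr (c' div 2), i := dtape L (h(nat k := c' mod 2 + 1)) k)"
  let ?v = "?u(3 := ctr (c' div 2), 4 := ctr 0)"
  show "runs (halve i ;; carry_back ;; Move i MoveL ;; Move 0 MoveL) ?s (15 * p + 9)
    (s(0 := dtape L h0 (k + 1), 3 := ctr (c' div 2),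
      i := dtape L (h(nat k := c' mod 2 + 1)) (k + 1)))"
  proof (rule runs_Seq)
    show "runs (halve i) ?s (3 * c' + 5) ?u"
      by (rule runs_halve) (use assms(1-7) in auto)
    show "runs (carry_back ;; Move i MoveL ;; Move 0 MoveL) ?u (3 * (c' div 2) + 3)
      (s(0 := dtape L h0 (k + 1), 3 := ctr (c' div 2),
        i := dtape L (h(nat k := c' mod 2 + 1)) (k + 1)))"
    proof (rule runs_Seq)
      show "runs carry_back ?u (3 * (c' div 2) + 1) ?v"
        by (rule runs_carry_back) (use assms(1) in auto)
      show "runs (Move i MoveL ;; Move 0 MoveL) ?v 2 (s(0 := dtape L h0 (k + 1),
          3 := ctr (c' div 2), i := dtape L (h(nat k := c' mod 2 + 1)) (k + 1)))"
        using assms(1-7) by (auto intro!: runs_Move_Seq runs_Move1 simp: fun_eq_iff)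
    qed auto
    show "3 * c' + 5 + (3 * (c' div 2) + 3) \<le> 15 * p + 9"
      using \<open>c' < 2 * p\<close> by linarith
  qed
qed (use assms(11) in linarith)

text \<open>In-place long multiplication from the units upwards. After \<open>k\<close> rounds the
  low \<open>k\<close> digits are those of \<open>p * a\<close>, the others still those of
  \<open>a\<close>, and the carry is \<open>p * (a mod 2 ^ k) div 2 ^ k\<close>. The ruler moves
  along, so its head ends at the bit length of the product.\<close>

lemma runs_mult_reg:
  assumes "4 < i" and "s 0 = dtape L h 0" and "s 1 = reg p 0" and "s 3 = ctr 0" and "s 4 = ctr 0"
    and "s i = dtape L (digit a) 0" and "0 < p" and "0 < a"
    and "bitlen (p * a) * (20 * p + 13) + 1 \<le> T"
  shows "runs (mult_reg i) s T (s(0 := dtape L h (int (bitlen (p * a))),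
    i := dtape L (digit (p * a)) (int (bitlen (p * a)))))"
  unfolding mult_reg_def
proof (rule runs_While)
  define n where "n = bitlen (p * a)"
  define cy where "cy k = p * (a mod 2 ^ k) div 2 ^ k" for k
  define hd where "hd k = (\<lambda>j. if j < k then digit (p * a) j else digit a j)" for k
  let ?f = "\<lambda>k. s(0 := dtape L h (int k), 3 := ctr (cy k), i := dtape L (hd k) (int k))"
  show "holds [(i, 0), (3, 1)] (scans (?f k)) \<and>
      runs (mult_digit i) (?f k) (20 * p + 12) (?f (Suc k))" if "k < bitlen (p * a)" for k
  proof -
    let ?r = "a mod 2 ^ k" and ?b = "a div 2 ^ k mod 2" and ?q = "a div 2 ^ Suc k"
    have le: "2 ^ k \<le> p * a" using that by (simp add: less_bitlen_iff)
    \<comment> \<open>The digits of \<open>a\<close> above bit \<open>k\<close> contribute an even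
      amount to \<open>p * a div 2 ^ k\<close>, so the carry and the current digit alone decide
      digit \<open>k\<close> of the product.\<close>
    have "p * a = p * ?r + (p * ?b + 2 * p * ?q) * 2 ^ k"
    proof -
      have "a = ?r + a div 2 ^ k * 2 ^ k" by (metis mod_div_mult_eq)
      moreover have "a div 2 ^ k = ?b + 2 * ?q"
        by (simp add: div_mult2_eq power_Suc2 del: power_Suc)
      ultimately have "a = ?r + (?b + 2 * ?q) * 2 ^ k" by metis
      then have "p * a = p * (?r + (?b + 2 * ?q) * 2 ^ k)" by (rule arg_cong)
      then show ?thesis by (simp only: algebra_simps)
    qed
    then have "p * a div 2 ^ k = (p * ?r + (p * ?b + 2 * p * ?q) * 2 ^ k) div 2 ^ k"
      by (rule arg_cong)
    then have "p * a div 2 ^ k = cy k + p * ?b + 2 * p * ?q"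
      by (simp add: cy_def)
    then have dig: "digit (p * a) k = (cy k + p * ?b) mod 2 + 1"
      using le by (simp add: digit_def mult.assoc)
    have "a mod 2 ^ Suc k = ?r + ?b * 2 ^ k"
      by (simp add: mod_mult2_eq power_Suc2 del: power_Suc)
    then have cy_Suc: "cy (Suc k) = (cy k + p * ?b) div 2"
      by (simp add: cy_def div_mult2_eq power_Suc2 distrib_left flip: mult.assoc del: power_Suc)
    have hd_Suc: "hd (Suc k) = (hd k)(k := (cy k + p * ?b) mod 2 + 1)"
      by (auto simp: hd_def dig fun_eq_iff less_Suc_eq)
    have "cy k < p"
      using assms(7) by (simp add: cy_def less_mult_imp_div_less)
    moreover have "(if hd k (nat (int k)) = 2 then cy k + p else cy k) = cy k + p * ?b"
      by (auto simp: hd_def digit_def div_eq_0_iff)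
    ultimately have "runs (mult_digit i) (?f k) (20 * p + 12)
        ((?f k)(0 := dtape L h (int k + 1), 3 := ctr ((cy k + p * ?b) div 2),
          i := dtape L ((hd k)(nat (int k) := (cy k + p * ?b) mod 2 + 1)) (int k + 1)))"
      using assms(1,3,5,7)
      by (intro runs_mult_digit[where p = p and c = "cy k"]) auto
    also have "(?f k)(0 := dtape L h (int k + 1), 3 := ctr ((cy k + p * ?b) div 2),
          i := dtape L ((hd k)(nat (int k) := (cy k + p * ?b) mod 2 + 1)) (int k + 1)) = ?f (Suc k)"
      using assms(1) unfolding hd_Suc cy_Suc by (auto simp: fun_eq_iff ac_simps)
    finally have "runs (mult_digit i) (?f k) (20 * p + 12) (?f (Suc k))" .
    \<comment> \<open>The loop does not stop early: once the digits of \<open>a\<close> are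
      exhausted, the carry is \<open>p * a div 2 ^ k\<close>, which is positive while
      \<open>k\<close> is below the bit length of the product.\<close>
    moreover have "hd k k \<noteq> 0 \<or> 0 < cy k"
    proof (cases "k < bitlen a")
      case True
      then show ?thesis by (simp add: hd_def digit_eq_0_iff)
    next
      case False
      then have "?r = a" by (simp add: less_bitlen_iff)
      then show ?thesis using le by (simp add: cy_def div_greater_zero_iff)
    qed
    ultimately show ?thesis
      using assms(1) by auto
  qed
  have "bitlen a \<le> n" using assms(7) unfolding n_def by (intro bitlen_mono) simp
  then have "cy n = 0"
    using bitlen_le_iff[of a n] bitlen_le_iff[of "p * a" n] by (simp add: cy_def n_def)
  have "digit a j = digit (p * a) j" if "\<not> j < n" for j
    using that \<open>bitlen a \<le> n\<close> digit_eq_0_iff[of a j] digit_eq_0_iff[of "p * a" j] by (simp add: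
        n_def)
  then have hd: "hd n = digit (p * a)"
    by (auto simp: hd_def fun_eq_iff)
  with \<open>cy n = 0\<close> show "\<not> holds [(i, 0), (3, 1)] (scans (?f (bitlen (p * a))))"
    using assms(1) by (auto simp: n_def digit_eq_0_iff)
  show "s(0 := dtape L h (int (bitlen (p * a))), i := dtape L (digit (p * a)) (int (bitlen (p *
      a)))) =
      ?f (bitlen (p * a))"
    using assms(1,4) hd \<open>cy n = 0\<close> by (auto simp: n_def fun_upd_eq_iff)
  have "hd 0 = digit a" "cy 0 = 0" by (auto simp: hd_def cy_def)
  then show "s = ?f 0"
    using assms by (auto simp: fun_upd_eq_iff eq_commute[of s])
qed (use assms(9) in \<open>simp add: ac_simps\<close>)

text \<open>\<open>reg 0 n\<close> describes a register whose value mark is erased: in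
  \<open>reg\<close> the test for cell \<open>0\<close> comes first, so only the origin mark is
  left.\<close>

lemma put_reg [simp]:
  "0 < n \<Longrightarrow> put 0 (reg n n) = reg 0 n"
  "0 < n \<Longrightarrow> put 2 (reg 0 n) = reg n n"
  by (auto simp: put_def reg_def fun_eq_iff)

definition div_test :: com where
  "div_test = While [(1, 2)]
     (Move 1 MoveR ;; Move 2 MoveR ;; Cond [(2, 2)] (Move 0 Stay) (rewind 2)) ;; rewind 1"

lemma runs_Stay: "1 \<le> T \<Longrightarrow> runs (Move i Stay) s T s"
  by (intro runs_Move) (auto simp: shift_def)

text \<open>While the head of tape 1 walks to \<open>p\<close>, that of tape 2 cycles through
  \<open>0, ..., d - 1\<close>, being rewound whenever it meets the mark at \<open>d\<close>. Its
  final position is the remainder, and it scans \<open>1\<close> exactly if \<open>d\<close> divides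
  \<open>p\<close>.\<close>

lemma runs_div_test:
  assumes "s 1 = reg p 0" and "s 2 = reg d 0" and "0 < d" and "0 < p" and "p * (2 * d + 7) + 2 \<le> T"
  shows "runs div_test s T (s(2 := reg d (p mod d)))"
  unfolding div_test_def
proof (rule runs_Seq)
  let ?f = "\<lambda>j. s(1 := reg p j, 2 := reg d (j mod d))"
  let ?c = "Move 1 MoveR ;; Move 2 MoveR ;; Cond [(2, 2)] (Move 0 Stay) (rewind 2)"
  show "runs (While [(1, 2)] ?c) s (Suc (p * Suc (2 * d + 4))) (?f p)"
  proof (rule runs_While[where f = ?f and n = p and T = "2 * d + 4"])
    fix j assume "j < p"
    have "j mod d < d" using assms(3) by simp
    have "runs ?c (?f j) (2 * d + 4) (?f (Suc j))"
    proof (rule runs_Move_Seq[where T = "2 * d + 3"], rule runs_Move_Seq[where T = "2 * d + 2"],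
        rule runs_Cond[where T = "2 * d + 1"])
      let ?t = "s(1 := reg p (Suc j), 2 := reg d (Suc (j mod d)))"
      have t: "(?f j)(1 := shift MoveR (?f j 1),
          2 := shift MoveR (((?f j)(1 := shift MoveR (?f j 1))) 2)) = ?t"
        by (auto simp: fun_eq_iff)
      {
        assume "holds [(2, 2)] (scans ((?f j)(1 := shift MoveR (?f j 1),
          2 := shift MoveR (((?f j)(1 := shift MoveR (?f j 1))) 2))))"
        then have "Suc (j mod d) \<noteq> d" unfolding t by auto
        then have "Suc j mod d = Suc (j mod d)" by (simp add: mod_Suc)
        then show "runs (Move 0 Stay) ((?f j)(1 := shift MoveR (?f j 1),
          2 := shift MoveR (((?f j)(1 := shift MoveR (?f j 1))) 2))) (2 * d + 1) (?f (Suc j))"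
          unfolding t by (simp add: runs_Stay)
      next
        assume "\<not> holds [(2, 2)] (scans ((?f j)(1 := shift MoveR (?f j 1),
          2 := shift MoveR (((?f j)(1 := shift MoveR (?f j 1))) 2))))"
        then have "Suc (j mod d) = d" unfolding t by (auto split: if_splits)
        then have "Suc j mod d = 0" by (simp add: mod_Suc)
        have "runs (rewind 2) ?t (2 * d + 1) (?t(2 := reg d 0))"
          by (rule runs_rewind[where k = "Suc (j mod d)"]) (use \<open>Suc (j mod d) = d\<close> in auto)
        also have "?t(2 := reg d 0) = ?f (Suc j)"
          by (simp add: \<open>Suc j mod d = 0\<close>)
        finally show "runs (rewind 2) ((?f j)(1 := shift MoveR (?f j 1),
          2 := shift MoveR (((?f j)(1 := shift MoveR (?f j 1))) 2))) (2 * d + 1) (?f (Suc j))"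
          unfolding t .
      }
    qed auto
    then show "holds [(1, 2)] (scans (?f j)) \<and> runs ?c (?f j) (2 * d + 4) (?f (Suc j))"
      using \<open>j < p\<close> by auto
  qed (use assms in \<open>auto simp: fun_eq_iff\<close>)
  have "runs (rewind 1) (?f p) (2 * p + 1) ((?f p)(1 := reg p 0))"
    by (rule runs_rewind[where k = p]) simp_all
  also have "(?f p)(1 := reg p 0) = s(2 := reg d (p mod d))"
    using assms by (auto simp: fun_eq_iff)
  finally show "runs (rewind 1) (?f p) (2 * p + 1) (s(2 := reg d (p mod d)))" .
  show "Suc (p * Suc (2 * d + 4)) + (2 * p + 1) \<le> T"
    using assms(5) by (simp add: algebra_simps)
qed

definition incr :: "nat \<Rightarrow> com" where
  "incr i = forward i ;; Write i 0 ;; Move i MoveR ;; Write i 2 ;; rewind i"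

text \<open>The head may start anywhere up to the mark: after a failed trial division it stands at
  the remainder.\<close>

lemma runs_incr:
  assumes "s i = reg n k" and "k \<le> n" and "0 < n" and "4 * n + 7 \<le> T"
  shows "runs (incr i) s T (s(i := reg (Suc n) 0))"
  unfolding incr_def
proof (rule runs_Seq)
  show "runs (forward i) s (2 * n + 1) (s(i := reg n n))"
    by (rule runs_forward[where k = k]) (use assms in auto)
  show "runs (Write i 0 ;; Move i MoveR ;; Write i 2 ;; rewind i) (s(i := reg n n)) (2 * n + 6)
      (s(i := reg (Suc n) 0))"
  proof (rule runs_Write_Seq[where T = "2 * n + 5"], rule runs_Move_Seq[where T = "2 * n + 4"],
      rule runs_Write_Seq[where T = "2 * n + 3"])
    let ?t = "s(i := reg (Suc n) (Suc n))"
    have "runs (rewind i) ?t (2 * n + 3) (?t(i := reg (Suc n) 0))"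
      by (rule runs_rewind[where k = "Suc n"]) auto
    moreover have "s(i := reg n n, i := put 0 ((s(i := reg n n)) i),
        i := shift MoveR ((s(i := reg n n, i := put 0 ((s(i := reg n n)) i))) i),
        i := put 2 ((s(i := reg n n, i := put 0 ((s(i := reg n n)) i),
           i := shift MoveR ((s(i := reg n n, i := put 0 ((s(i := reg n n)) i))) i))) i)) = ?t"
      using assms(3) by simp
    ultimately show "runs (rewind i) (s(i := reg n n, i := put 0 ((s(i := reg n n)) i),
        i := shift MoveR ((s(i := reg n n, i := put 0 ((s(i := reg n n)) i))) i),
        i := put 2 ((s(i := reg n n, i := put 0 ((s(i := reg n n)) i),
           i := shift MoveR ((s(i := reg n n, i := put 0 ((s(i := reg n n)) i))) i))) i)))
        (2 * n + 3) (s(i := reg (Suc n) 0))"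
      by simp
  qed auto
qed (use assms(4) in auto)

section \<open>Primality by trial division\<close>

definition least_div :: "nat \<Rightarrow> nat" where
  "least_div p = (LEAST d. 2 \<le> d \<and> d dvd p)"

lemma least_div:
  assumes "2 \<le> p"
  shows "2 \<le> least_div p" and "least_div p dvd p" and "least_div p \<le> p"
    and "\<And>d. 2 \<le> d \<Longrightarrow> d < least_div p \<Longrightarrow> \<not> d dvd p"
    and "least_div p = p \<longleftrightarrow> prime p"
proof -
  have ex: "2 \<le> p \<and> p dvd p" using assms by simp
  show 1: "2 \<le> least_div p" and 2: "least_div p dvd p"
    unfolding least_div_def using LeastI[of "\<lambda>d. 2 \<le> d \<and> d dvd p", OF ex] by auto
  show le: "least_div p \<le> p"
    using 2 assms by (auto dest: dvd_imp_le)
  show 3: "\<not> d dvd p" if "2 \<le> d" "d < least_div p" for d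
    using that not_less_Least unfolding least_div_def by blast
  show "least_div p = p \<longleftrightarrow> prime p"
  proof
    assume "least_div p = p"
    have "d = 1 \<or> d = p" if "d dvd p" for d
    proof -
      have "d \<noteq> 0" "d \<le> p" using that assms dvd_imp_le[OF that] by (auto intro!: Nat.gr0I)
      moreover have "2 \<le> d \<Longrightarrow> \<not> d < p" using 3[of d] that \<open>least_div p = p\<close> by auto
      ultimately show ?thesis by linarith
    qed
    then show "prime p" using assms by (auto simp: prime_nat_iff)
  next
    assume "prime p"
    then show "least_div p = p" using 1 2 by (auto simp: prime_nat_iff)
  qed
qed

definition find_div :: com where
  "find_div = div_test ;; While [(2, 1)] (incr 2 ;; div_test)"

lemma runs_find_div:
  assumes "s 1 = reg p 0" and "s 2 = reg 2 0" and "2 \<le> p"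
    and "p * (2 * p * p + 11 * p + 21) + 3 \<le> T"
  shows "runs find_div s T (s(2 := reg (least_div p) 0))"
  unfolding find_div_def
proof (rule runs_Seq)
  let ?f = "\<lambda>j. s(2 := reg (2 + j) (p mod (2 + j)))" and ?n = "least_div p - 2"
  note ld = least_div[OF assms(3)]
  show "runs div_test s (p * 11 + 2) (?f 0)"
    using assms(1-3) runs_div_test[of s p 2 "p * 11 + 2"] by simp
  show "runs (While [(2, 1)] (incr 2 ;; div_test)) (?f 0)
      (Suc (p * Suc (p * (2 * p + 11) + 9))) (s(2 := reg (least_div p) 0))"
  proof (rule runs_While[where f = ?f and n = ?n and T = "p * (2 * p + 11) + 9"])
    fix j assume j: "j < ?n"
    then have "\<not> 2 + j dvd p" using ld(4) by auto
    then have nz: "p mod (2 + j) \<noteq> 0" by (simp add: dvd_eq_mod_eq_0)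
    have lt: "p mod (2 + j) < 2 + j" by simp
    have "runs (incr 2 ;; div_test) (?f j) (p * (2 * p + 11) + 9) (?f (Suc j))"
    proof (rule runs_Seq)
      let ?u = "s(2 := reg (2 + Suc j) 0)"
      have "runs (incr 2) (?f j) (4 * p + 7) ((?f j)(2 := reg (Suc (2 + j)) 0))"
        by (rule runs_incr[where k = "p mod (2 + j)"]) (use lt j ld(3) in auto)
      then show "runs (incr 2) (?f j) (4 * p + 7) ?u"
        by simp
      have "p * (2 * (2 + Suc j) + 7) \<le> p * (2 * p + 7)"
        using j ld(3) by (intro mult_left_mono) auto
      then have "runs div_test ?u (p * (2 * p + 7) + 2) (?u(2 := reg (2 + Suc j) (p mod (2 + Suc
          j))))"
        by (intro runs_div_test) (use assms(1,3) in auto)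
      then show "runs div_test ?u (p * (2 * p + 7) + 2) (?f (Suc j))"
        by simp
    qed (simp add: algebra_simps)
    then show "holds [(2, 1)] (scans (?f j)) \<and>
        runs (incr 2 ;; div_test) (?f j) (p * (2 * p + 11) + 9) (?f (Suc j))"
      using nz by simp
  next
    have "p mod least_div p = 0" "2 + ?n = least_div p" using ld(1,2) by auto
    then show "\<not> holds [(2, 1)] (scans (?f ?n))" "s(2 := reg (least_div p) 0) = ?f ?n"
      by simp_all
    have "?n * Suc (p * (2 * p + 11) + 9) \<le> p * Suc (p * (2 * p + 11) + 9)"
      using ld(3) by (intro mult_right_mono) auto
    then show "Suc (?n * Suc (p * (2 * p + 11) + 9)) \<le> Suc (p * Suc (p * (2 * p + 11) + 9))"
      by simp
  qed simp
qed (use assms(4) in \<open>simp add: algebra_simps\<close>)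

definition compare :: com where
  "compare = While [(2, 2)] (Move 2 MoveR ;; Move 1 MoveR)"

text \<open>Turns the primality criterion \<open>least_div p = p\<close> into a tape test: with both
  heads at \<open>d\<close>, tape 1 scans its mark \<open>2\<close> exactly if
  \<open>d = p\<close>.\<close>

lemma runs_compare:
  assumes "s 1 = reg p 0" and "s 2 = reg d 0" and "0 < d" and "d \<le> p" and "3 * p + 1 \<le> T"
  shows "runs compare s T (s(1 := reg p d, 2 := reg d d))"
  unfolding compare_def
proof (rule runs_While[where f = "\<lambda>j. s(1 := reg p j, 2 := reg d j)" and n = d and T = 2])
  fix j assume "j < d"
  then show "holds [(2, 2)] (scans (s(1 := reg p j, 2 := reg d j))) \<and>
      runs (Move 2 MoveR ;; Move 1 MoveR) (s(1 := reg p j, 2 := reg d j)) 2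
        (s(1 := reg p (Suc j), 2 := reg d (Suc j)))"
    by (auto intro!: runs_Move_Seq runs_Move1 simp: fun_eq_iff)
qed (use assms in \<open>auto simp: fun_eq_iff\<close>)

definition reset :: com where
  "reset = rewind 1 ;; Write 2 0 ;; rewind 2 ;; Move 2 MoveR ;; Move 2 MoveR ;; Write 2 2 ;;
     Move 2 MoveL ;; Move 2 MoveL"

lemma runs_reset:
  assumes "s 1 = reg p k" and "s 2 = reg d d" and "0 < d" and "k \<le> p" and "d \<le> p"
    and "4 * p + 8 \<le> T"
  shows "runs reset s T (s(1 := reg p 0, 2 := reg 2 0))"
  unfolding reset_def
proof (rule runs_Seq)
  show "runs (rewind 1) s (2 * p + 1) (s(1 := reg p 0))"
    by (rule runs_rewind[where k = k]) (use assms in auto)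
  show "runs (Write 2 0 ;; rewind 2 ;; Move 2 MoveR ;; Move 2 MoveR ;; Write 2 2 ;;
     Move 2 MoveL ;; Move 2 MoveL) (s(1 := reg p 0)) (2 * p + 7) (s(1 := reg p 0, 2 := reg 2 0))"
  proof (rule runs_Write_Seq[where T = "2 * p + 6"], rule runs_Seq)
    show "runs (rewind 2) (s(1 := reg p 0, 2 := put 0 ((s(1 := reg p 0)) 2))) (2 * p + 1)
        (s(1 := reg p 0, 2 := reg 0 0))"
      using runs_rewind[of "s(1 := reg p 0, 2 := reg 0 d)" 2 0 d "2 * p + 1"] assms by simp
    show "runs (Move 2 MoveR ;; Move 2 MoveR ;; Write 2 2 ;; Move 2 MoveL ;; Move 2 MoveL)
        (s(1 := reg p 0, 2 := reg 0 0)) 5 (s(1 := reg p 0, 2 := reg 2 0))"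
      by (rule runs_Move_Seq[where T = 4], rule runs_Move_Seq[where T = 3],
          rule runs_Write_Seq[where T = 2], rule runs_Move_Seq[where T = 1], rule runs_Move)
        (auto simp flip: numeral_2_eq_2)
  qed auto
qed (use assms in auto)

section \<open>Rewinding, erasing and copying binary numbers\<close>

definition rewind2 :: "nat \<Rightarrow> nat \<Rightarrow> com" where
  "rewind2 i j = Move i MoveR ;; Move j MoveR ;; While [(i, 0)] (Move i MoveR ;; Move j MoveR) ;;
     Move i MoveL ;; Move j MoveL"

text \<open>The head of tape \<open>i\<close> starts on the blank left of the leading digit. The
  first move enters the number, the loop runs to the blank right of the units digit, at position
  \<open>-1\<close>, and the last moves step back to position \<open>0\<close>.\<close>

lemma runs_rewind2:
  assumes "s i = dtape L (digit a) (int n)" and "s j = dtape L' h (int n)" and "n = bitlen a" and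
      "i \<noteq> j"
    and "3 * n + 5 \<le> T"
  shows "runs (rewind2 i j) s T (s(i := dtape L (digit a) 0, j := dtape L' h 0))"
  unfolding rewind2_def
proof (rule runs_Move_Seq[where T = "3 * n + 4"], rule runs_Move_Seq[where T = "3 * n + 3"],
    rule runs_Seq)
  let ?f = "\<lambda>k. s(i := dtape L (digit a) (int n - 1 - int k), j := dtape L' h (int n - 1 - int k))"
  show "runs (While [(i, 0)] (Move i MoveR ;; Move j MoveR))
      (s(i := shift MoveR (s i), j := shift MoveR ((s(i := shift MoveR (s i))) j)))
      (Suc (n * Suc 2)) (?f n)"
  proof (rule runs_While[where f = ?f and n = n and T = 2])
    fix k assume "k < n"
    then show "holds [(i, 0)] (scans (?f k)) \<and>
        runs (Move i MoveR ;; Move j MoveR) (?f k) 2 (?f (Suc k))"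
      using assms(3,4)
      by (auto intro!: runs_Move_Seq runs_Move1 simp: fun_eq_iff digit_eq_0_iff algebra_simps)
  qed (use assms in \<open>auto simp: fun_eq_iff\<close>)
  show "runs (Move i MoveL ;; Move j MoveL) (?f n) 2
      (s(i := dtape L (digit a) 0, j := dtape L' h 0))"
    using assms(4) by (auto intro!: runs_Move_Seq runs_Move1 simp: fun_eq_iff)
qed (use assms in auto)

definition erase :: com where
  "erase = Move 6 MoveR ;; Move 0 MoveR ;;
     While [(6, 0)] (Write 6 0 ;; Move 6 MoveR ;; Move 0 MoveR) ;; Move 6 MoveL ;; Move 0 MoveL"

lemma runs_erase:
  assumes "s 6 = dtape L (digit a) (int n)" and "s 0 = dtape L' h (int n)" and "n = bitlen a"
    and "4 * n + 5 \<le> T"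
  shows "runs erase s T (s(6 := dtape L (digit 0) 0, 0 := dtape L' h 0))"
  unfolding erase_def
proof (rule runs_Move_Seq[where T = "4 * n + 4"], rule runs_Move_Seq[where T = "4 * n + 3"],
    rule runs_Seq)
  let ?f = "\<lambda>k. s(6 := dtape L (\<lambda>r. if r < n - k then digit a r else 0) (int n - 1 - int k),
    0 := dtape L' h (int n - 1 - int k))"
  have trunc: "(\<lambda>r. if r < n then digit a r else 0) = digit a"
    using assms(3) by (auto simp: fun_eq_iff digit_eq_0_iff)
  show "runs (While [(6, 0)] (Write 6 0 ;; Move 6 MoveR ;; Move 0 MoveR))
      (s(6 := shift MoveR (s 6), 0 := shift MoveR ((s(6 := shift MoveR (s 6))) 0)))
      (Suc (n * Suc 3)) (?f n)"
  proof (rule runs_While[where f = ?f and n = n and T = 3])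
    fix k assume k: "k < n"
    let ?h = "\<lambda>r. if r < n - k then digit a r else 0"
    have off: "int n - 1 - int k = int (n - Suc k)" "int n - 1 - int (Suc k) = int (n - Suc k) - 1"
      using k by auto
    have h: "?h(n - Suc k := 0) = (\<lambda>r. if r < n - Suc k then digit a r else 0)"
      using k by (auto simp: fun_eq_iff)
    have "runs (Write 6 0 ;; Move 6 MoveR ;; Move 0 MoveR) (?f k) 3 (?f (Suc k))"
      unfolding off
      by (intro runs_Write_Seq[where T = 2] runs_Move_Seq[where T = 1] runs_Move)
        (simp_all add: h fun_upd_eq_iff del: fun_upd_apply, simp add: h)
    moreover have "digit a (n - Suc k) \<noteq> 0" "n - Suc k < n - k"
      using assms(3) k by (auto simp: digit_eq_0_iff)
    then have "holds [(6, 0)] (scans (?f k))"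
      by (simp only: off, simp del: of_nat_diff)
    ultimately show "holds [(6, 0)] (scans (?f k)) \<and>
        runs (Write 6 0 ;; Move 6 MoveR ;; Move 0 MoveR) (?f k) 3 (?f (Suc k))"
      by (intro conjI)
  qed (use assms trunc in \<open>auto simp: fun_upd_eq_iff\<close>)
  show "runs (Move 6 MoveL ;; Move 0 MoveL) (?f n) 2
      (s(6 := dtape L (digit 0) 0, 0 := dtape L' h 0))"
    by (auto intro!: runs_Move_Seq runs_Move1 simp: fun_eq_iff)
qed (use assms in auto)

definition copy :: com where
  "copy = While [(5, 0)] (Cond [(5, 2)] (Write 6 1) (Write 6 2) ;; Move 5 MoveL ;; Move 6 MoveL) ;;
     rewind2 5 6"

lemma runs_copy:
  assumes "s 5 = dtape L (digit a) 0" and "s 6 = dtape L (digit 0) 0" and "n = bitlen a"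
    and "8 * n + 6 \<le> T"
  shows "runs copy s T (s(6 := dtape L (digit a) 0))"
  unfolding copy_def
proof (rule runs_Seq)
  let ?h = "\<lambda>k r. if r < k then digit a r else 0"
  let ?f = "\<lambda>k. s(5 := dtape L (digit a) (int k), 6 := dtape L (?h k) (int k))"
  let ?c = "Cond [(5, 2)] (Write 6 1) (Write 6 2) ;; Move 5 MoveL ;; Move 6 MoveL"
  have h_n: "?h n = digit a"
    using assms(3) by (auto simp: fun_eq_iff digit_eq_0_iff)
  show "runs (While [(5, 0)] ?c) s (Suc (n * Suc 4)) (?f n)"
  proof (rule runs_While[where f = ?f and n = n and T = 4])
    fix k assume k: "k < n"
    have h_Suc: "?h (Suc k) = (?h k)(k := digit a k)"
      by (auto simp: fun_eq_iff less_Suc_eq)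
    have "digit a k \<noteq> 0" using assms(3) k by (simp add: digit_eq_0_iff)
    then have d: "digit a k = 1 \<or> digit a k = 2"
      by (auto simp: digit_def split: if_splits)
    have "runs ?c (?f k) 4 (?f (Suc k))"
    proof (rule runs_Seq)
      show "runs (Cond [(5, 2)] (Write 6 1) (Write 6 2)) (?f k) 2
          (s(5 := dtape L (digit a) (int k), 6 := dtape L (?h (Suc k)) (int k)))"
        unfolding h_Suc using d
        by (intro runs_Cond[where T = 1] runs_Write) (auto simp: fun_upd_eq_iff)
      show "runs (Move 5 MoveL ;; Move 6 MoveL)
          (s(5 := dtape L (digit a) (int k), 6 := dtape L (?h (Suc k)) (int k))) 2 (?f (Suc k))"
        by (rule runs_Move_Seq[where T = 1], rule runs_Move) (auto simp: fun_upd_eq_iff add.commute)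
    qed simp
    then show "holds [(5, 0)] (scans (?f k)) \<and> runs ?c (?f k) 4 (?f (Suc k))"
      using \<open>digit a k \<noteq> 0\<close> by simp
  next
    show "\<not> holds [(5, 0)] (scans (?f n))"
      using assms(3) by (simp add: digit_eq_0_iff)
  qed (use assms in \<open>auto simp: fun_upd_eq_iff fun_eq_iff\<close>)
  show "runs (rewind2 5 6) (?f n) (3 * n + 5) (s(6 := dtape L (digit a) 0))"
  proof -
    have "runs (rewind2 5 6) (?f n) (3 * n + 5)
        ((?f n)(5 := dtape L (digit a) 0, 6 := dtape L (digit a) 0))"
      by (rule runs_rewind2) (use assms(3) h_n in auto)
    also have "(?f n)(5 := dtape L (digit a) 0, 6 := dtape L (digit a) 0) = s(6 := dtape L (digit
        a) 0)"
      using assms(1) by (auto simp: fun_upd_eq_iff)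
    finally show ?thesis .
  qed
qed (use assms in auto)

section \<open>The greedy search\<close>

definition init_reg :: "nat \<Rightarrow> com" where
  "init_reg i = Write i 1 ;; Move i MoveR ;; Move i MoveR ;; Write i 2 ;; Move i MoveL ;; Move i
      MoveL"

lemma runs_init_reg:
  assumes "s i = (\<lambda>_. 0, 0)"
  shows "runs (init_reg i) s 6 (s(i := reg 2 0))"
  unfolding init_reg_def
  by (rule runs_Write_Seq[where T = 5], rule runs_Move_Seq[where T = 4], rule runs_Move_Seq[where
      T = 3],
      rule runs_Write_Seq[where T = 2], rule runs_Move_Seq[where T = 1], rule runs_Move)
    (auto simp: assms put_def shift_def reg_def fun_upd_eq_iff fun_eq_iff)

definition init_tapes :: com where
  "init_tapes = init_reg 1 ;; init_reg 2 ;; Write 3 1 ;; Write 4 1 ;;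
     While [(0, 0)] (Move 0 MoveR ;; Move 5 MoveR ;; Move 6 MoveR) ;;
     Move 0 MoveL ;; Move 5 MoveL ;; Move 6 MoveL ;; Write 5 2"

text \<open>Tape 0 holds the input, which serves only as a ruler of length \<open>L\<close>; its head moves along
  with those of the number tapes, and it scans a blank once \<open>L\<close> digits have been passed. Tape 1
  holds the current candidate \<open>p\<close>, tape 2 the trial divisor, tapes 3 and 4 the carry of a
  multiplication, tape 5 the accumulator \<open>a\<close> and tape 6 the trial product.\<close>

definition stage :: "nat \<Rightarrow> nat \<Rightarrow> nat \<Rightarrow> nat \<Rightarrow> nat \<Rightarrow> nat \<Rightarrow> tapes" where
  "stage x p a b k l = (\<lambda>_. (\<lambda>_. 0, 0))(0 := dtape (bitlen x) (digit x) (int k), 1 := reg p 0, 2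
      := reg 2 0,
     3 := ctr 0, 4 := ctr 0, 5 := dtape (bitlen x) (digit a) 0, 6 := dtape (bitlen x) (digit b)
         (int l))"

lemma runs_eqI: "runs c s T t \<Longrightarrow> t = t' \<Longrightarrow> runs c s T t'"
  by simp

text \<open>Tapes 5 and 6 move along while tape 0 runs past the right end of the input, so that
  position \<open>0\<close> of all three becomes cell \<open>bitlen x - 1\<close>.\<close>

lemma runs_init_tapes: "runs init_tapes (start x) (4 * bitlen x + 20) (stage x 2 1 0 0 0)"
  unfolding init_tapes_def
proof (rule runs_Seq)
  let ?L = "bitlen x"
  show "runs (init_reg 1) (start x) 6 ((start x)(1 := reg 2 0))"
    by (rule runs_init_reg) (simp add: start_def)
  let ?s = "(start x)(1 := reg 2 0, 2 := reg 2 0)"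
  let ?t = "?s(3 := ctr 0, 4 := ctr 0)"
  let ?f = "\<lambda>j. ?t(0 := dtape ?L (digit x) (int ?L - 1 - int j),
    5 := dtape ?L (\<lambda>_. 0) (int ?L - 1 - int j), 6 := dtape ?L (\<lambda>_. 0) (int ?L - 1 - int j))"
  show "runs (init_reg 2 ;; Write 3 1 ;; Write 4 1 ;;
     While [(0, 0)] (Move 0 MoveR ;; Move 5 MoveR ;; Move 6 MoveR) ;;
     Move 0 MoveL ;; Move 5 MoveL ;; Move 6 MoveL ;; Write 5 2) ((start x)(1 := reg 2 0))
     (4 * ?L + 14) (stage x 2 1 0 0 0)"
  proof (rule runs_Seq)
    show "runs (init_reg 2) ((start x)(1 := reg 2 0)) 6 ?s"
      by (rule runs_init_reg) (simp add: start_def)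
    have "(?s(3 := put 1 (?s 3)))(4 := put 1 ((?s(3 := put 1 (?s 3))) 4)) = ?t"
      by (auto simp: start_def put_def ctr_def fun_upd_eq_iff)
    moreover have "runs (While [(0, 0)] (Move 0 MoveR ;; Move 5 MoveR ;; Move 6 MoveR) ;;
        Move 0 MoveL ;; Move 5 MoveL ;; Move 6 MoveL ;; Write 5 2) ?t (4 * ?L + 6) (stage x 2 1 0
            0 0)"
    proof (rule runs_Seq)
      show "runs (While [(0, 0)] (Move 0 MoveR ;; Move 5 MoveR ;; Move 6 MoveR)) ?t
          (Suc (?L * Suc 3)) (?f ?L)"
      proof (rule runs_While[where f = ?f and n = ?L and T = 3])
        fix j assume j: "j < ?L"
        have "runs (Move 0 MoveR ;; Move 5 MoveR ;; Move 6 MoveR) (?f j) 3 (?f (Suc j))"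
          by (rule runs_Move_Seq[where T = 2], rule runs_Move_Seq[where T = 1], rule runs_Move)
            (auto simp: fun_upd_eq_iff algebra_simps)
        moreover have "int ?L - 1 - int j = int (?L - Suc j)" and "digit x (?L - Suc j) \<noteq> 0"
          using j by (auto simp: digit_eq_0_iff)
        then have "holds [(0, 0)] (scans (?f j))"
          by (simp del: of_nat_diff)
        ultimately show "holds [(0, 0)] (scans (?f j)) \<and>
            runs (Move 0 MoveR ;; Move 5 MoveR ;; Move 6 MoveR) (?f j) 3 (?f (Suc j))"
          by blast
      next
        show "?t = ?f 0"
          using tape_word_bin[of x] by (auto simp: start_def dtape_def fun_upd_eq_iff)
      qed auto
      show "runs (Move 0 MoveL ;; Move 5 MoveL ;; Move 6 MoveL ;; Write 5 2) (?f ?L) 4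
          (stage x 2 1 0 0 0)"
        by (rule runs_Move_Seq[where T = 3], rule runs_Move_Seq[where T = 2],
            rule runs_Move_Seq[where T = 1], rule runs_Write)
          (auto simp: fun_upd_eq_iff stage_def start_def digit_1)
    qed simp
    ultimately show "runs (Write 3 1 ;; Write 4 1 ;;
       While [(0, 0)] (Move 0 MoveR ;; Move 5 MoveR ;; Move 6 MoveR) ;;
       Move 0 MoveL ;; Move 5 MoveL ;; Move 6 MoveL ;; Write 5 2) ?s (4 * ?L + 8) (stage x 2 1 0 0
           0)"
      by (intro runs_Write_Seq[where T = "4 * ?L + 7" and U = "4 * ?L + 8"]
          runs_Write_Seq[where T = "4 * ?L + 6" and U = "4 * ?L + 7"]) simp_all
  qed simp
qed simp

definition attempt :: com where
  "attempt = copy ;; mult_reg 6 ;;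
     Cond [(0, 0)]
       (rewind2 6 0 ;; mult_reg 6 ;; Cond [(0, 0)] (erase ;; mult_reg 5 ;; rewind2 5 0) erase)
       (Move 0 Stay)"

text \<open>After a multiplication the guard \<open>[(0, 0)]\<close> asks whether the ruler head is
  still on the input, that is, whether the product has fewer than \<open>bitlen x\<close> digits. If
  \<open>p * a\<close> is long enough, the ruler head stays beyond the input, which also ends the
  main loop. Otherwise \<open>p\<close> is either rejected for lack of room or absorbed into the
  accumulator. At most three multiplications account for the coefficient 60.\<close>

lemma runs_attempt:
  fixes a p x n :: nat
  assumes "0 < a" and "0 < p" and "bitlen (p * (p * a)) \<le> n" and "n * (60 * p + 57) + 26 \<le> T"
    and s': "s' =
      (if bitlen x \<le> bitlen (p * a) then stage x p a (p * a) (bitlen (p * a)) (bitlen (p * a))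
       else if bitlen x \<le> bitlen (p * (p * a)) then stage x p a 0 0 0 else stage x p (p * a) 0 0 0)"
  shows "runs attempt (stage x p a 0 0 0) T s'"
proof -
  let ?M = "n * (20 * p + 13) + 1"
  let ?n1 = "bitlen (p * a)" and ?n2 = "bitlen (p * (p * a))"
  have n: "?n1 \<le> n" "bitlen a \<le> n" "?n2 \<le> n"
    using assms(1-3) order_trans[OF bitlen_mono[of a "p * a"]]  order_trans[OF bitlen_mono[of "p *
        a" "p * (p * a)"]]
    by auto
  have 1: "runs copy (stage x p a 0 0 0) (8 * n + 6) (stage x p a a 0 0)"
    by (rule runs_eqI, rule runs_copy[where a = a and L = "bitlen x" and n = "bitlen a"])
      (use n in \<open>auto simp: stage_def fun_upd_eq_iff\<close>)
  have mult_le: "bitlen m * (20 * p + 13) + 1 \<le> ?M" if "bitlen m \<le> n" for m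
    using that by (intro add_mono mult_mono) auto
  have 2: "runs (mult_reg 6) (stage x p a a 0 0) ?M (stage x p a (p * a) ?n1 ?n1)"
    by (rule runs_eqI, rule runs_mult_reg[where a = a and L = "bitlen x" and p = p and h = "digit
        x"])
      (use assms(1,2) n mult_le in \<open>auto simp: stage_def fun_upd_eq_iff\<close>)
  have 3: "runs (rewind2 6 0) (stage x p a (p * a) ?n1 ?n1) (3 * n + 5) (stage x p a (p * a) 0 0)"
    by (rule runs_eqI, rule runs_rewind2[where a = "p * a" and L = "bitlen x" and n = ?n1])
      (use n in \<open>auto simp: stage_def fun_upd_eq_iff\<close>)
  have 4: "runs (mult_reg 6) (stage x p a (p * a) 0 0) ?M (stage x p a (p * (p * a)) ?n2 ?n2)"
    by (rule runs_eqI, rule runs_mult_reg[where a = "p * a" and L = "bitlen x" and p = p and h =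
        "digit x"])
      (use assms(1,2) n mult_le in \<open>auto simp: stage_def fun_upd_eq_iff\<close>)
  have 5: "runs erase (stage x p a (p * (p * a)) ?n2 ?n2) (4 * n + 5) (stage x p a 0 0 0)"
    by (rule runs_eqI, rule runs_erase[where a = "p * (p * a)" and L = "bitlen x" and n = ?n2])
      (use n in \<open>auto simp: stage_def fun_upd_eq_iff\<close>)
  let ?u = "(stage x p a 0 0 0)(0 := dtape (bitlen x) (digit x) (int ?n1),
    5 := dtape (bitlen x) (digit (p * a)) (int ?n1))"
  have 6: "runs (mult_reg 5) (stage x p a 0 0 0) ?M ?u"
    by (rule runs_mult_reg) (use assms(1,2) n mult_le in \<open>auto simp: stage_def\<close>)
  have 7: "runs (rewind2 5 0) ?u (3 * n + 5) (stage x p (p * a) 0 0 0)"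
    by (rule runs_eqI, rule runs_rewind2[where a = "p * a" and L = "bitlen x" and n = ?n1])
      (use n in \<open>auto simp: stage_def fun_upd_eq_iff\<close>)
  have holds_stage: "holds [(0, 0)] (scans (stage x p a b k l)) \<longleftrightarrow> k < bitlen x" for b k l
    using digit_eq_0_iff[of x k] by (auto simp: stage_def)
  have 8: "runs (Cond [(0, 0)] (erase ;; mult_reg 5 ;; rewind2 5 0) erase)
      (stage x p a (p * (p * a)) ?n2 ?n2) (?M + 7 * n + 11)
      (if bitlen x \<le> ?n2 then stage x p a 0 0 0 else stage x p (p * a) 0 0 0)"
  proof (rule runs_Cond[where T = "?M + 7 * n + 10"])
    have "runs (erase ;; mult_reg 5 ;; rewind2 5 0) (stage x p a (p * (p * a)) ?n2 ?n2)
        (?M + 7 * n + 10) (stage x p (p * a) 0 0 0)"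
      by (rule runs_Seq[OF 5 runs_Seq[OF 6 7 order_refl]]) simp
    then show "runs (erase ;; mult_reg 5 ;; rewind2 5 0) (stage x p a (p * (p * a)) ?n2 ?n2)
        (?M + 7 * n + 10) (if bitlen x \<le> ?n2 then stage x p a 0 0 0 else stage x p (p * a) 0 0 0)"
      if "holds [(0, 0)] (scans (stage x p a (p * (p * a)) ?n2 ?n2))"
      using that unfolding holds_stage by simp
    show "runs erase (stage x p a (p * (p * a)) ?n2 ?n2)
        (?M + 7 * n + 10) (if bitlen x \<le> ?n2 then stage x p a 0 0 0 else stage x p (p * a) 0 0 0)"
      if "\<not> holds [(0, 0)] (scans (stage x p a (p * (p * a)) ?n2 ?n2))"
      using that runs_mono[OF 5, of "?M + 7 * n + 10"] unfolding holds_stage by simp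
  qed simp
  have 9: "runs (Cond [(0, 0)]
       (rewind2 6 0 ;; mult_reg 6 ;; Cond [(0, 0)] (erase ;; mult_reg 5 ;; rewind2 5 0) erase)
       (Move 0 Stay)) (stage x p a (p * a) ?n1 ?n1) (2 * ?M + 10 * n + 17) s'"
  proof (rule runs_Cond[where T = "2 * ?M + 10 * n + 16"])
    have "runs (rewind2 6 0 ;; mult_reg 6 ;; Cond [(0, 0)] (erase ;; mult_reg 5 ;; rewind2 5 0)
        erase)
      (stage x p a (p * a) ?n1 ?n1) (2 * ?M + 10 * n + 16)
      (if bitlen x \<le> ?n2 then stage x p a 0 0 0 else stage x p (p * a) 0 0 0)"
      by (rule runs_Seq[OF 3 runs_Seq[OF 4 8 order_refl]]) simp
    then show "runs (rewind2 6 0 ;; mult_reg 6 ;; Cond [(0, 0)] (erase ;; mult_reg 5 ;; rewind2 5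
        0) erase)
      (stage x p a (p * a) ?n1 ?n1) (2 * ?M + 10 * n + 16) s'"
      if "holds [(0, 0)] (scans (stage x p a (p * a) ?n1 ?n1))"
      using that unfolding holds_stage by (simp add: s')
    show "runs (Move 0 Stay) (stage x p a (p * a) ?n1 ?n1) (2 * ?M + 10 * n + 16) s'"
      if "\<not> holds [(0, 0)] (scans (stage x p a (p * a) ?n1 ?n1))"
      using that unfolding holds_stage by (simp add: s' runs_Stay)
  qed simp
  show ?thesis
    unfolding attempt_def
    by (rule runs_Seq[OF 1 runs_Seq[OF 2 9 order_refl]]) (use assms(4) in \<open>simp add: algebra_simps\<close>)
qed

definition try_next :: com where
  "try_next = find_div ;; compare ;; Cond [(1, 2)] reset (reset ;; attempt) ;; incr 1"

text \<open>The state \<open>s'\<close> is left abstract, so that a composite \<open>p\<close> and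
  all outcomes of \<open>attempt\<close> for a prime \<open>p\<close> are handled at once.\<close>

lemma runs_try_next:
  assumes "2 \<le> p" and "prime p \<Longrightarrow> runs attempt (stage x p a 0 0 0) T s'"
    and "\<not> prime p \<Longrightarrow> s' = stage x p a 0 0 0" and "s' 1 = reg p 0"
    and "p * (2 * p * p + 11 * p + 32) + 20 + T \<le> U"
  shows "runs try_next (stage x p a 0 0 0) U (s'(1 := reg (Suc p) 0))"
proof -
  let ?s = "stage x p a 0 0 0" and ?d = "least_div p"
  note ld = least_div[OF assms(1)]
  have 1: "runs find_div ?s (p * (2 * p * p + 11 * p + 21) + 3) (?s(2 := reg ?d 0))"
    by (rule runs_find_div) (use assms(1) in \<open>auto simp: stage_def\<close>)
  let ?u = "?s(2 := reg ?d ?d, 1 := reg p ?d)"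
  have 2: "runs compare (?s(2 := reg ?d 0)) (3 * p + 1) ?u"
    by (rule runs_eqI, rule runs_compare[where p = p and d = ?d])
      (use ld in \<open>auto simp: stage_def fun_upd_eq_iff\<close>)
  have 3: "runs reset ?u (4 * p + 8) ?s"
    by (rule runs_eqI, rule runs_reset[where p = p and d = ?d and k = ?d])
      (use ld in \<open>auto simp: stage_def fun_upd_eq_iff\<close>)
  have 4: "runs (Cond [(1, 2)] reset (reset ;; attempt)) ?u (4 * p + 9 + T) s'"
  proof (rule runs_Cond[where T = "4 * p + 8 + T"])
    assume "holds [(1, 2)] (scans ?u)"
    then have "\<not> prime p"
      using ld(1,5) by auto
    then show "runs reset ?u (4 * p + 8 + T) s'"
      using assms(3) runs_mono[OF 3] by simp
  next
    assume "\<not> holds [(1, 2)] (scans ?u)"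
    then have "prime p"
      using ld(1,5) by (auto split: if_splits)
    then show "runs (reset ;; attempt) ?u (4 * p + 8 + T) s'"
      using assms(2) by (intro runs_Seq[OF 3 _ order_refl]) simp
  qed simp
  have 5: "runs (incr 1) s' (4 * p + 7) (s'(1 := reg (Suc p) 0))"
    by (rule runs_incr[where k = 0]) (use assms(1,4) in auto)
  show ?thesis
    unfolding try_next_def
    by (rule runs_Seq[OF 1 runs_Seq[OF 2 runs_Seq[OF 4 5 order_refl] order_refl]])
      (use assms(5) in \<open>simp add: algebra_simps\<close>)
qed

text \<open>The accumulator before candidate \<open>p\<close> is examined, with the stopping test
  left out: a total function that describes tape 5 up to the prime at which the search
  stops.\<close>

fun acc :: "nat \<Rightarrow> nat \<Rightarrow> nat" where
  "acc L 0 = 1"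
| "acc L (Suc p) = (if prime p \<and> bitlen (p * (p * acc L p)) < L then p * acc L p else acc L p)"

lemma acc_pos: "0 < acc L p"
  by (induction p) (auto dest: prime_gt_0_nat)

lemma acc_mono:
  assumes "p \<le> q"
  shows "acc L p \<le> acc L q"
proof (rule lift_Suc_mono_le[OF _ assms])
  show "acc L n \<le> acc L (Suc n)" for n
    using prime_gt_0_nat[of n] by auto
qed

definition greedy :: com where
  "greedy = init_tapes ;; While [(0, 0)] try_next"

lemma wf_greedy: "wf_com 7 3 greedy"
  by (simp add: greedy_def init_tapes_def init_reg_def try_next_def find_div_def div_test_def
      incr_def compare_def reset_def attempt_def copy_def rewind2_def mult_reg_def mult_digit_def
      add_reg_def halve_def carry_back_def erase_def)

definition round_time :: "nat \<Rightarrow> nat \<Rightarrow> nat" where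
  "round_time q n = q * (2 * q * q + 11 * q + 32) + n * (60 * q + 57) + 46"

text \<open>\<open>q\<close> is the first prime whose product reaches the length of
  \<open>x\<close>, so \<open>acc\<close> describes tape 5 until then. All candidates are at most
  \<open>q\<close> and all trial products have at most \<open>n\<close> bits, whence one bound
  \<open>round_time q n\<close> serves for every round.\<close>

lemma runs_greedy:
  assumes "prime q" and "0 < bitlen x" and "bitlen x \<le> bitlen (q * acc (bitlen x) q)"
    and "\<And>p. prime p \<Longrightarrow> p < q \<Longrightarrow> bitlen (p * acc (bitlen x) p) < bitlen x"
    and "n = bitlen (q * (q * acc (bitlen x) q))"
  shows "\<exists>s'. runs greedy (start x) (4 * bitlen x + 21 + q * Suc (round_time q n)) s' \<and>
    fst (s' 6) = fst (dtape (bitlen x) (digit (q * acc (bitlen x) q)) k)"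
proof -
  let ?L = "bitlen x" and ?A = "acc (bitlen x)"
  let ?m = "bitlen (q * acc (bitlen x) q)"
  let ?end = "(stage x q (?A q) (q * ?A q) ?m ?m)(1 := reg (Suc q) 0)"
  \<comment> \<open>The candidates run from 2 to \<open>q\<close>, hence \<open>q - 1\<close>
    rounds. In \<open>?end\<close> tape 1 already holds \<open>Suc q\<close>, because a round
    increments the candidate even after success.\<close>
  let ?f = "\<lambda>j. if j + 2 \<le> q then stage x (j + 2) (?A (j + 2)) 0 0 0 else ?end"
  have q: "2 \<le> q" using assms(1) by (rule prime_ge_2_nat)
  have holds_stage: "holds [(0, 0)] (scans (stage x p a b k l)) \<longleftrightarrow> k < ?L" for p a b k l
    using digit_eq_0_iff[of x k] by (auto simp: stage_def)
  have "runs try_next (stage x p (?A p) 0 0 0) (round_time q n)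
      (if p < q then stage x (Suc p) (?A (Suc p)) 0 0 0 else ?end)" if p: "2 \<le> p" "p \<le> q" for p
  proof -
    have "p * (p * ?A p) \<le> q * (q * ?A q)"
      using p acc_mono[OF p(2)] by (intro mult_mono) auto
    then have n: "bitlen (p * (p * ?A p)) \<le> n"
      using assms(5) bitlen_mono by simp
    define s' where "s' = (if \<not> prime p then stage x p (?A p) 0 0 0
      else if ?L \<le> bitlen (p * ?A p) then stage x p (?A p) (p * ?A p) (bitlen (p * ?A p)) (bitlen
          (p * ?A p))
      else if ?L \<le> bitlen (p * (p * ?A p)) then stage x p (?A p) 0 0 0 else stage x p (p * ?A p) 0
          0 0)"
    have le: "p * (2 * p * p + 11 * p + 32) + 20 + (n * (60 * p + 57) + 26) \<le> round_time q n"
    proof -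
      have "p * (2 * p * p + 11 * p + 32) \<le> q * (2 * q * q + 11 * q + 32)"
        using p by (intro mult_mono add_mono) auto
      moreover have "n * (60 * p + 57) \<le> n * (60 * q + 57)"
        using p by (intro mult_mono add_mono) auto
      ultimately show ?thesis unfolding round_time_def by linarith
    qed
    have "runs try_next (stage x p (?A p) 0 0 0) (round_time q n) (s'(1 := reg (Suc p) 0))"
    proof (rule runs_try_next[OF p(1) _ _ _ le])
      assume "prime p"
      then show "runs attempt (stage x p (?A p) 0 0 0) (n * (60 * p + 57) + 26) s'"
        using p acc_pos n by (intro runs_attempt[where n = n]) (auto simp: s'_def)
    qed (auto simp: s'_def stage_def)
    also have "s'(1 := reg (Suc p) 0) =
      (if p < q then stage x (Suc p) (?A (Suc p)) 0 0 0 else ?end)"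
    proof (cases "p < q")
      case True
      have "s' = stage x p (?A (Suc p)) 0 0 0"
        using assms(4)[OF _ True] by (auto simp: s'_def)
      then show ?thesis using True by (auto simp: stage_def fun_upd_eq_iff)
    next
      case False
      with p have "p = q" by simp
      then show ?thesis using assms(1,3) by (simp add: s'_def)
    qed
    finally show ?thesis .
  qed
  note step = this
  have "runs (While [(0, 0)] try_next) (stage x 2 1 0 0 0) (Suc ((q - 1) * Suc (round_time q n)))
      ?end"
  proof (rule runs_While[where f = ?f and n = "q - 1" and T = "round_time q n"])
    fix j assume "j < q - 1"
    then have j: "2 \<le> j + 2" "j + 2 \<le> q" by auto
    then have "?f (Suc j) =
        (if j + 2 < q then stage x (Suc (j + 2)) (?A (Suc (j + 2))) 0 0 0 else ?end)"
      by simp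
    then show "holds [(0, 0)] (scans (?f j)) \<and> runs try_next (?f j) (round_time q n) (?f (Suc j))"
      using step[OF j] j assms(2) by (simp only: holds_stage if_True)
  next
    have f_end: "?f (q - 1) = ?end" using q by simp
    have "scans ?end 0 = scans (stage x q (?A q) (q * ?A q) ?m ?m) 0" by simp
    then have "holds [(0, 0)] (scans ?end) \<longleftrightarrow> holds [(0, 0)] (scans (stage x q (?A q) (q * ?A q) ?m
        ?m))"
      by (simp only: holds_Cons holds_Nil)
    then show "\<not> holds [(0, 0)] (scans (?f (q - 1)))"
      unfolding f_end holds_stage using assms(3) by simp
    show "?end = ?f (q - 1)" using f_end by simp
    have "acc ?L 2 = 1" by (simp add: numeral_2_eq_2)
    then show "stage x 2 1 0 0 0 = ?f 0" using q by (simp add: numeral_2_eq_2)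
  qed simp
  moreover have "(q - 1) * Suc (round_time q n) \<le> q * Suc (round_time q n)"
    by (intro mult_right_mono) auto
  ultimately have "runs greedy (start x) (4 * ?L + 21 + q * Suc (round_time q n)) ?end"
    unfolding greedy_def by (intro runs_Seq[OF runs_init_tapes]) (assumption, linarith)
  moreover have "fst (?end 6) = fst (dtape ?L (digit (q * ?A q)) k)"
    by (simp add: stage_def dtape_def)
  ultimately show ?thesis by blast
qed

text \<open>The ruler for input \<open>0\<close> is empty, so the loop is not entered;
  \<open>poly_time\<close> demands halting on this input as well.\<close>

lemma runs_prog_0: "\<exists>s'. runs greedy (start 0) 21 s'"
proof
  have "runs (While [(0, 0)] try_next) (stage 0 2 1 0 0 0) 1 (stage 0 2 1 0 0 0)"
    by (rule runs_While[where n = 0]) (auto simp: stage_def)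
  then show "runs greedy (start 0) 21 (stage 0 2 1 0 0 0)"
    unfolding greedy_def by (intro runs_Seq[OF runs_init_tapes]) auto
qed

section \<open>Estimates for primes\<close>

text \<open>Legendre's formula. From \<open>n\<close> to \<open>Suc n\<close> the
  \<open>k\<close>-th term grows by one exactly if \<open>p ^ k dvd Suc n\<close>, and such
  \<open>k\<close> do not exceed \<open>N\<close>. The free cut-off \<open>N\<close> lets the
  formulas for different factorials be subtracted termwise.\<close>

lemma multiplicity_fact:
  fixes p :: nat
  assumes "prime p" and "n \<le> N"
  shows "multiplicity p (fact n) = (\<Sum>k=1..N. n div p ^ k)"
  using assms(2)
proof (induction n)
  case (Suc n)
  have p: "2 \<le> p" using assms(1) by (rule prime_ge_2_nat)
  have mult_lt: "multiplicity p (Suc n) \<le> N"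
  proof -
    have "p ^ multiplicity p (Suc n) \<le> Suc n"
      by (intro dvd_imp_le multiplicity_dvd) simp
    moreover have "multiplicity p (Suc n) < p ^ multiplicity p (Suc n)"
      using p by (intro power_gt_expt) auto
    ultimately show ?thesis using Suc.prems by linarith
  qed
  have "Suc n div p ^ k = n div p ^ k + (if k \<in> {1..multiplicity p (Suc n)} then 1 else 0)"
    if "k \<in> {1..N}" for k
    using that assms(1) p
    by (auto simp: div_Suc power_dvd_iff_le_multiplicity[symmetric] mod_eq_0_iff_dvd)
  then have "(\<Sum>k=1..N. Suc n div p ^ k) =
      (\<Sum>k=1..N. n div p ^ k) + (\<Sum>k=1..N. if k \<in> {1..multiplicity p (Suc n)} then 1 else 0)"
    by (simp only: sum.distrib cong: sum.cong)
  also have "(\<Sum>k=1..N. if k \<in> {1..multiplicity p (Suc n)} then 1 else 0) =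
      card ({1..N} \<inter> {1..multiplicity p (Suc n)})"
    by (subst sum.inter_restrict[symmetric]) auto
  also have "{1..N} \<inter> {1..multiplicity p (Suc n)} = {1..multiplicity p (Suc n)}"
    using mult_lt by auto
  also have "multiplicity p (fact (Suc n)) = multiplicity p (Suc n) + multiplicity p (fact n)"
    using assms(1) unfolding fact_Suc of_nat_id
    by (intro prime_elem_multiplicity_mult_distrib) auto
  ultimately show ?case using Suc by simp
qed simp

section \<open>Prime powers in the central binomial coefficient\<close>

lemma double_div_le: "2 * (n div m) \<le> 2 * n div (m :: nat)"
proof (cases "m = 0")
  case False
  then show ?thesis
    using times_div_less_eq_dividend[of m n] by (simp add: less_eq_div_iff_mult_less_eq ac_simps)
qed simp

lemma double_div_diff_le: "2 * n div m - 2 * (n div m) \<le> (1 :: nat)"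
proof (cases "m = 0")
  case False
  have "2 * n = (2 * (n div m)) * m + 2 * (n mod m)"
    by (metis add_mult_distrib2 div_mult_mod_eq mult.assoc)
  then have "2 * n div m = 2 * (n div m) + 2 * (n mod m) div m"
    using False by (metis add.commute div_mult_self1)
  moreover have "2 * (n mod m) < 2 * m" using False by simp
  then have "2 * (n mod m) div m < 2" by (simp add: less_mult_imp_div_less)
  ultimately show ?thesis by linarith
qed simp

lemma multiplicity_central_binomial:
  fixes p n :: nat
  assumes "prime p"
  shows "multiplicity p (2 * n choose n) = (\<Sum>k=1..2*n. 2 * n div p ^ k - 2 * (n div p ^ k))"
proof -
  have "fact n * fact n * (2 * n choose n) = (fact (2 * n) :: nat)"
    using binomial_fact_lemma[of n "2 * n"] by (simp add: mult_2)
  then have "multiplicity p (fact (2 * n)) = multiplicity p (fact n * fact n * (2 * n choose n))"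
    by simp
  also have "\<dots> = 2 * multiplicity p (fact n) + multiplicity p (2 * n choose n)"
    using assms by (simp add: prime_elem_multiplicity_mult_distrib)
  finally have "multiplicity p (2 * n choose n) =
      (\<Sum>k=1..2*n. 2 * n div p ^ k) - (\<Sum>k=1..2*n. 2 * (n div p ^ k))"
    using multiplicity_fact[OF assms, of n "2 * n"] multiplicity_fact[OF assms, of "2 * n" "2 * n"]
    by (simp add: sum_distrib_left)
  also have "\<dots> = (\<Sum>k=1..2*n. 2 * n div p ^ k - 2 * (n div p ^ k))"
    by (rule sum_subtractf_nat[symmetric]) (rule double_div_le)
  finally show ?thesis .
qed


text \<open>The multiplicity \<open>v\<close> is a sum of terms that are at most 1 and vanish once
  \<open>p ^ k > 2 * n\<close>. If \<open>p ^ v > 2 * n\<close>, only the \<open>v - 1\<close> terms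
  with \<open>k < v\<close> could contribute.\<close>

lemma prime_power_central_binomial_le:
  fixes p n :: nat
  assumes "prime p" and "0 < n"
  shows "p ^ multiplicity p (2 * n choose n) \<le> 2 * n"
proof (rule ccontr)
  let ?v = "multiplicity p (2 * n choose n)"
  assume "\<not> ?thesis"
  then have gt: "2 * n < p ^ ?v" by simp
  have p: "2 \<le> p" using assms(1) by (rule prime_ge_2_nat)
  have "?v \<noteq> 0" using gt assms(2) by (intro notI) simp
  have "?v = (\<Sum>k=1..2*n. 2 * n div p ^ k - 2 * (n div p ^ k))"
    by (rule multiplicity_central_binomial[OF assms(1)])
  also have "\<dots> \<le> (\<Sum>k=1..2*n. if k \<in> {1..<?v} then 1 else 0)"
  proof (rule sum_mono)
    fix k assume k: "k \<in> {1..2*n}"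
    show "2 * n div p ^ k - 2 * (n div p ^ k) \<le> (if k \<in> {1..<?v} then 1 else 0)"
    proof (cases "k < ?v")
      case True
      then show ?thesis using k double_div_diff_le[of n "p ^ k"] by simp
    next
      case False
      then have "p ^ ?v \<le> p ^ k" using p by (intro power_increasing) auto
      then have "2 * n < p ^ k" using gt by linarith
      then show ?thesis by simp
    qed
  qed
  also have "\<dots> = card ({1..2*n} \<inter> {1..<?v})"
    by (subst sum.inter_restrict[symmetric]) auto
  also have "\<dots> \<le> card {1..<?v}"
    by (rule card_mono) auto
  finally show False using \<open>?v \<noteq> 0\<close> by simp
qed

text \<open>The term for \<open>k = 1\<close> is \<open>2 - 2 * 1\<close>, and for larger
  \<open>k\<close> already \<open>p ^ k\<close> is at least \<open>3 * p > 2 * n\<close>.\<close>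

lemma multiplicity_central_binomial_eq_0:
  fixes p n :: nat
  assumes "prime p" and "2 < p" and "2 * n < 3 * p" and "p \<le> n"
  shows "multiplicity p (2 * n choose n) = 0"
proof -
  have "2 * n div p ^ k - 2 * (n div p ^ k) = 0" if "k \<in> {1..2*n}" for k
  proof (cases "k = 1")
    case True
    have "n div p = 1" "2 * n div p = 2"
      using assms by (intro div_nat_eqI; simp)+
    then show ?thesis using True by simp
  next
    case False
    with that have "p ^ 2 \<le> p ^ k" using assms(2) by (intro power_increasing) auto
    moreover have "3 * p \<le> p ^ 2" using assms(2) by (simp add: power2_eq_square)
    ultimately have "2 * n < p ^ k" using assms(3) by linarith
    then show ?thesis by simp
  qed
  then show ?thesis
    unfolding multiplicity_central_binomial[OF assms(1)] by simp
qed

section \<open>Primorials\<close>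

lemma prod_primes_dvd:
  fixes N :: nat
  assumes "finite S" and "\<And>p. p \<in> S \<Longrightarrow> prime p \<and> p dvd N"
  shows "\<Prod>S dvd N"
  using assms
proof (induction S rule: finite_induct)
  case (insert p S)
  have "coprime p (\<Prod>S)"
    using insert by (intro prod_coprime_right) (metis insertCI primes_coprime)
  then have "p * \<Prod>S dvd N"
    using insert by (intro divides_mult) auto
  then show ?case using insert by simp
qed simp

text \<open>The bound is strict to match \<open>acc L n\<close>, the accumulator before
  \<open>n\<close> is examined.\<close>

definition primorial :: "nat \<Rightarrow> nat" where
  "primorial n = \<Prod>{p. prime p \<and> p < n}"

lemma primorial_Suc: "primorial (Suc n) = (if prime n then n * primorial n else primorial n)"
proof -
  have "{p. prime p \<and> p < Suc n} =
      (if prime n then insert n {p. prime p \<and> p < n} else {p. prime p \<and> p < n})"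
    by (auto simp: less_Suc_eq)
  then show ?thesis by (auto simp: primorial_def)
qed

lemma primorial_0 [simp]: "primorial 0 = 1"
  by (simp add: primorial_def)

lemma primorial_pos: "0 < primorial n"
  by (induction n) (auto simp: primorial_Suc prime_gt_0_nat)

lemma primorial_mono: "m \<le> n \<Longrightarrow> primorial m \<le> primorial n"
proof (rule lift_Suc_mono_le[of primorial])
  show "primorial k \<le> primorial (Suc k)" for k
    using prime_gt_0_nat[of k] by (auto simp: primorial_Suc)
qed

text \<open>Erdos's induction. An even \<open>n > 2\<close> adds no prime. For
  \<open>n = 2 * m + 1\<close> the primes from \<open>m + 2\<close> to \<open>n\<close> divide
  \<open>n choose m\<close>, which is at most \<open>4 ^ m\<close> as a term of the lower half of
  the binomial sum; the primes up to \<open>m + 1\<close> are covered by induction.\<close>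

lemma primorial_le: "primorial (Suc n) \<le> 4 ^ n"
proof (induction n rule: less_induct)
  case (less n)
  consider "n = 0" | "n = 2" | "n \<noteq> 0" "n \<noteq> 2" "even n" | m where "n = 2 * m + 1"
    by (metis oddE)
  then show ?case
  proof cases
    case 2
    then show ?thesis by (simp add: primorial_Suc numeral_2_eq_2)
  next
    case 3
    then have "\<not> prime n"
      using prime_odd_nat[of n] prime_ge_2_nat[of n] by force
    then have "primorial (Suc n) = primorial (Suc (n - 1))"
      using 3 by (simp add: primorial_Suc)
    also have "\<dots> \<le> 4 ^ (n - 1)"
      using 3 by (intro less) auto
    also have "\<dots> \<le> 4 ^ n" by (intro power_increasing) auto
    finally show ?thesis .
  next
    case 4
    show ?thesis
    proof (cases "m = 0")
      case False
      let ?S = "{p. prime p \<and> m + 2 \<le> p \<and> p \<le> 2 * m + 1}"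
      have S: "{p. prime p \<and> p < Suc n} = {p. prime p \<and> p < Suc (Suc m)} \<union> ?S"
        using 4 by auto
      have *: "primorial (Suc n) = primorial (Suc (Suc m)) * \<Prod>?S"
        unfolding primorial_def S by (rule prod.union_disjoint) auto
      have "\<Prod>?S dvd (2 * m + 1 choose m)"
      proof (rule prod_primes_dvd)
        fix p assume p: "p \<in> ?S"
        then have "p dvd fact m * fact (2 * m + 1 - m) * (2 * m + 1 choose m)"
          by (subst binomial_fact_lemma) (auto simp: prime_dvd_fact_iff simp del: fact_Suc)
        then have "p dvd (2 * m + 1 choose m)"
          using p by (auto simp: prime_dvd_mult_iff prime_dvd_fact_iff simp del: fact_Suc)
        then show "prime p \<and> p dvd (2 * m + 1 choose m)" using p by simp
      qed simp
      then have "\<Prod>?S \<le> (2 * m + 1 choose m)"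
        by (rule dvd_imp_le) simp
      moreover have "(2 * m + 1 choose m) \<le> (\<Sum>k\<le>m. 2 * m + 1 choose k)"
        by (rule member_le_sum) auto
      then have "(2 * m + 1 choose m) \<le> 4 ^ m"
        unfolding binomial_r_part_sum by (simp add: power_mult)
      ultimately have "\<Prod>?S \<le> 4 ^ m"
        by linarith
      moreover have "primorial (Suc (Suc m)) \<le> 4 ^ Suc m"
        using False 4 by (intro less) auto
      ultimately have "primorial (Suc n) \<le> 4 ^ Suc m * 4 ^ m"
        unfolding * by (intro mult_le_mono)
      also have "\<dots> = 4 ^ n" using 4 by (simp add: mult_2 flip: power_add)
      finally show ?thesis .
    qed (use 4 in \<open>simp add: primorial_Suc\<close>)
  qed (simp add: primorial_Suc)
qed

section \<open>Estimates of Chebyshev and Bertrand\<close>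

lemma central_binomial_le_power:
  assumes "0 < n"
  shows "(2 * n choose n) \<le> (2 * n) ^ card {p. prime p \<and> p \<le> 2 * n}"
proof -
  let ?C = "2 * n choose n" and ?S = "{p. prime p \<and> p \<le> 2 * n}"
  have pf: "prime_factors ?C \<subseteq> ?S"
  proof
    fix p assume p: "p \<in> prime_factors ?C"
    then have "p dvd fact n * fact (2 * n - n) * (2 * n choose n)"
      by (intro dvd_mult) auto
    then have "p dvd fact (2 * n)"
      by (subst (asm) binomial_fact_lemma) auto
    then show "p \<in> ?S"
      using p prime_dvd_fact_iff[of p "2 * n"] by (auto intro: in_prime_factors_imp_prime)
  qed
  have "?C = (\<Prod>p\<in>prime_factors ?C. p ^ multiplicity p ?C)"
    by (rule prime_factorization_nat) simp
  \<comment> \<open>Whatever its exponent, every prime contributes at most \<open>2 * n\<close>, so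
    a large binomial coefficient forces many primes.\<close>
  also have "\<dots> \<le> (\<Prod>p\<in>prime_factors ?C. 2 * n)"
    using assms by (intro prod_mono) (auto intro!: prime_power_central_binomial_le)
  also have "\<dots> = (2 * n) ^ card (prime_factors ?C)" by simp
  also have "\<dots> \<le> (2 * n) ^ card ?S"
    using assms pf by (intro power_increasing card_mono) auto
  finally show ?thesis .
qed

text \<open>Erdos's proof of Bertrand's postulate. Primes up to the square root of
  \<open>2 * n\<close> contribute at most \<open>2 * n\<close> each. A larger prime factor occurs
  only once and is at most \<open>2 * n div 3\<close>, by the hypothesis and
  \<open>multiplicity_central_binomial_eq_0\<close>, so a primorial bounds the product of
  these.\<close>

lemma central_binomial_le_without_prime:
  assumes "3 \<le> n" and "\<And>p. prime p \<Longrightarrow> n < p \<Longrightarrow> p \<le> 2 * n \<Longrightarrow> False"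
  shows "(2 * n choose n) \<le> (2 * n) ^ card {p. 0 < p \<and> p * p \<le> 2 * n} * 4 ^ (2 * n div 3)"
proof -
  let ?C = "2 * n choose n"
  let ?A = "{p \<in> prime_factors ?C. p * p \<le> 2 * n}" and ?B = "{p \<in> prime_factors ?C. 2 * n < p * p}"
  have fin: "finite {p :: nat. 0 < p \<and> p * p \<le> 2 * n}"
  proof (rule finite_subset)
    show "{p :: nat. 0 < p \<and> p * p \<le> 2 * n} \<subseteq> {..2 * n}"
      using le_square order_trans by blast
  qed simp
  have prime: "prime p" if "p \<in> prime_factors ?C" for p
    using that by (rule in_prime_factors_imp_prime)
  have B: "p \<le> 2 * n div 3 \<and> p ^ multiplicity p ?C \<le> p" if "p \<in> ?B" for p
  proof -
    have p: "prime p" "p dvd ?C" "2 * n < p * p" using that prime by auto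
    then have "p dvd fact n * fact (2 * n - n) * (2 * n choose n)"
      by (intro dvd_mult) auto
    then have "p dvd fact (2 * n)"
      by (subst (asm) binomial_fact_lemma) auto
    then have "p \<le> 2 * n"
      using p prime_dvd_fact_iff by blast
    then have "p \<le> n" using assms(2)[OF p(1)] by force
    have "2 < p"
    proof (rule ccontr)
      assume "\<not> 2 < p"
      then have "p * p \<le> 2 * 2" by (intro mult_mono) auto
      then show False using p(3) assms(1) by linarith
    qed
    have "multiplicity p ?C \<noteq> 0"
      using p \<open>2 < p\<close> power_dvd_iff_le_multiplicity[of ?C p 1] by auto
    then have "\<not> 2 * n < 3 * p"
      using multiplicity_central_binomial_eq_0[OF p(1) \<open>2 < p\<close> _ \<open>p \<le> n\<close>] by auto
    then have "p \<le> 2 * n div 3" by linarith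
    moreover have "multiplicity p ?C \<le> 1"
    proof (rule ccontr)
      assume "\<not> ?thesis"
      then have "p ^ 2 \<le> p ^ multiplicity p ?C"
        using \<open>2 < p\<close> by (intro power_increasing) auto
      then show False
        using prime_power_central_binomial_le[OF p(1), of n] assms(1) p(3)
        by (simp add: power2_eq_square)
    qed
    then have "p ^ multiplicity p ?C \<le> p ^ 1"
      using \<open>2 < p\<close> by (intro power_increasing) auto
    ultimately show ?thesis by simp
  qed
  have "?C = (\<Prod>p\<in>prime_factors ?C. p ^ multiplicity p ?C)"
    by (rule prime_factorization_nat) simp
  also have "prime_factors ?C = ?A \<union> ?B" by auto
  also have "(\<Prod>p\<in>?A \<union> ?B. p ^ multiplicity p ?C) =
      (\<Prod>p\<in>?A. p ^ multiplicity p ?C) * (\<Prod>p\<in>?B. p ^ multiplicity p ?C)"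
    by (rule prod.union_disjoint) auto
  also have "\<dots> \<le> (2 * n) ^ card {p. 0 < p \<and> p * p \<le> 2 * n} * 4 ^ (2 * n div 3)"
  proof (rule mult_mono)
    have "(\<Prod>p\<in>?A. p ^ multiplicity p ?C) \<le> (\<Prod>p\<in>?A. 2 * n)"
      using assms(1) prime by (intro prod_mono) (auto intro!: prime_power_central_binomial_le)
    also have "\<dots> = (2 * n) ^ card ?A" by simp
    also have "\<dots> \<le> (2 * n) ^ card {p. 0 < p \<and> p * p \<le> 2 * n}"
      using assms(1) fin prime by (intro power_increasing card_mono) (auto intro: prime_gt_0_nat)
    finally show "(\<Prod>p\<in>?A. p ^ multiplicity p ?C) \<le> (2 * n) ^ card {p. 0 < p \<and> p * p \<le> 2 * n}" .
    have "(\<Prod>p\<in>?B. p ^ multiplicity p ?C) \<le> \<Prod>?B"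
      using B by (intro prod_mono) auto
    also have "\<dots> \<le> primorial (Suc (2 * n div 3))"
      unfolding primorial_def
    proof (rule dvd_imp_le)
      show "\<Prod>?B dvd \<Prod>{p. prime p \<and> p < Suc (2 * n div 3)}"
        using B prime by (intro prod_dvd_prod_subset) (auto simp: less_Suc_eq_le)
      show "0 < \<Prod>{p. prime p \<and> p < Suc (2 * n div 3)}"
        using primorial_pos by (simp add: primorial_def)
    qed
    also have "\<dots> \<le> 4 ^ (2 * n div 3)" by (rule primorial_le)
    finally show "(\<Prod>p\<in>?B. p ^ multiplicity p ?C) \<le> 4 ^ (2 * n div 3)" .
  qed auto
  finally show ?thesis .
qed

lemma card_le_sqrt: "real (card {p :: nat. 0 < p \<and> p * p \<le> m}) \<le> sqrt (real m)"
proof -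
  have "{p :: nat. 0 < p \<and> p * p \<le> m} \<subseteq> {1..nat \<lfloor>sqrt (real m)\<rfloor>}"
  proof
    fix p :: nat assume p: "p \<in> {p. 0 < p \<and> p * p \<le> m}"
    then have "real (p * p) \<le> real m" by (subst of_nat_le_iff) simp
    then have "real p \<le> sqrt (real m)"
      by (intro real_le_rsqrt) (simp add: power2_eq_square)
    then show "p \<in> {1..nat \<lfloor>sqrt (real m)\<rfloor>}"
      using p by (simp add: le_nat_floor)
  qed
  then have "card {p :: nat. 0 < p \<and> p * p \<le> m} \<le> nat \<lfloor>sqrt (real m)\<rfloor>"
    using card_mono[of "{1..nat \<lfloor>sqrt (real m)\<rfloor>}"] by simp
  then have "real (card {p :: nat. 0 < p \<and> p * p \<le> m}) \<le> real (nat \<lfloor>sqrt (real m)\<rfloor>)"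
    by (rule of_nat_mono)
  also have "\<dots> \<le> sqrt (real m)" by (rule of_nat_floor) simp
  finally show ?thesis .
qed

text \<open>Without such a prime the previous bound contradicts
  \<open>4 ^ n / (2 * n) \<le> 2 * n choose n\<close> for large \<open>n\<close>: the missing factor
  of about \<open>4 powr (n / 3)\<close> cannot come from the subexponential term.\<close>

lemma eventually_prime_between: "\<forall>\<^sub>F n :: nat in at_top. \<exists>p. prime p \<and> n < p \<and> p \<le> 2 * n"
proof -
  have "\<forall>\<^sub>F n in at_top. 2 * real n * ((2 * real n) powr sqrt (2 * real n) * 4 powr (2 * real n /
      3))
      < 4 powr real n"
    by real_asymp
  then show ?thesis
    using eventually_ge_at_top[of 3]
  proof eventually_elim
    case (elim n)
    show ?case
    proof (rule ccontr)
      assume *: "\<not> ?thesis"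
      let ?k = "card {p. 0 < p \<and> p * p \<le> 2 * n}"
      have "4 ^ n / (2 * real n) \<le> real (2 * n choose n)"
        using elim(2) by (intro central_binomial_lower_bound) simp
      also have "\<dots> \<le> real ((2 * n) ^ ?k * 4 ^ (2 * n div 3))"
        using central_binomial_le_without_prime[OF elim(2)] * by (subst of_nat_le_iff) blast
      also have "\<dots> = (2 * real n) powr real ?k * 4 powr real (2 * n div 3)"
        using elim(2) by (simp add: powr_realpow)
      also have "\<dots> \<le> (2 * real n) powr sqrt (2 * real n) * 4 powr (2 * real n / 3)"
      proof (intro mult_mono powr_mono)
        show "real ?k \<le> sqrt (2 * real n)" using card_le_sqrt[of "2 * n"] by simp
        show "real (2 * n div 3) \<le> 2 * real n / 3" using of_nat_div_le_of_nat[of "2 * n" 3, where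
            ?'a = real] by simp
      qed (use elim(2) in auto)
      finally have "4 ^ n \<le> 2 * real n * ((2 * real n) powr sqrt (2 * real n) * 4 powr (2 * real n
          / 3))"
        using elim(2) by (simp add: field_simps)
      then show False using elim(1) by (simp add: powr_realpow)
    qed
  qed
qed

text \<open>Chebyshev's bound at \<open>L ^ 2\<close>: with fewer than \<open>L\<close> primes up to
  \<open>2 * L ^ 2\<close> the binomial coefficient would be at most \<open>(2 * L ^ 2) ^ L\<close>,
  which for large \<open>L\<close> is below \<open>2 ^ L ^ 2\<close>. So there are at least
  \<open>L\<close> primes, each at least 2.\<close>

lemma eventually_primorial_ge: "\<forall>\<^sub>F L in at_top. 2 ^ L \<le> primorial (2 * L ^ 2 + 1)"
proof -
  have "\<forall>\<^sub>F L :: nat in at_top. 2 * (real L)\<^sup>2 < 2 powr real L"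
    by real_asymp
  then show ?thesis
    using eventually_gt_at_top[of 0]
  proof eventually_elim
    case (elim L)
    let ?S = "{p. prime p \<and> p \<le> 2 * L ^ 2}"
    have "real (2 * L ^ 2) < real (2 ^ L)" using elim(1) by (simp add: powr_realpow)
    then have lt: "2 * L ^ 2 < 2 ^ L" by (subst (asm) of_nat_less_iff)
    have "L \<le> card ?S"
    proof (rule ccontr)
      assume "\<not> ?thesis"
      then have "card ?S \<le> L" by simp
      have "2 ^ L ^ 2 \<le> (2 * L ^ 2 choose L ^ 2)"
      proof -
        have "2 ^ n \<le> (2 * n choose n)" for n :: nat
        proof (induction n)
          case (Suc n)
          have "(2 * n choose n) \<le> (Suc (2 * n) choose n)" by (cases n) auto
          with Suc show ?case by simp
        qed simp
        then show ?thesis .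
      qed
      also have "\<dots> \<le> (2 * L ^ 2) ^ card ?S"
        using elim(2) by (intro central_binomial_le_power) simp
      also have "\<dots> \<le> (2 * L ^ 2) ^ L"
        using elim(2) \<open>card ?S \<le> L\<close> by (intro power_increasing) (auto simp: Suc_le_eq)
      also have "\<dots> < (2 ^ L) ^ L"
        using lt elim(2) by (intro power_strict_mono) auto
      also have "\<dots> = 2 ^ L ^ 2" by (simp add: power2_eq_square power_mult)
      finally show False by simp
    qed
    then have "(2::nat) ^ L \<le> 2 ^ card ?S" by (intro power_increasing) auto
    also have "\<dots> = (\<Prod>p\<in>?S. 2)" by simp
    also have "\<dots> \<le> \<Prod>?S" by (intro prod_mono) (auto intro: prime_ge_2_nat)
    also have "?S = {p. prime p \<and> p < 2 * L ^ 2 + 1}" by auto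
    finally show ?case unfolding primorial_def .
  qed
qed

section \<open>Bounds for the totient ratio\<close>

text \<open>Finite form of the Euler product. Split \<open>M\<close> by the multiplicity
  \<open>k\<close> of the new prime; dividing by \<open>p ^ k\<close> is injective on each class and
  leaves only primes of \<open>Q\<close>, so the classes add up to at most a partial geometric
  series times the product over \<open>Q\<close>.\<close>

lemma sum_inverse_smooth_le:
  fixes Q M :: "nat set"
  assumes "finite Q" and "\<And>p. p \<in> Q \<Longrightarrow> prime p" and "finite M"
    and "\<And>n. n \<in> M \<Longrightarrow> 0 < n \<and> prime_factors n \<subseteq> Q"
  shows "(\<Sum>n\<in>M. 1 / real n) \<le> (\<Prod>p\<in>Q. 1 / (1 - 1 / real p))"
  using assms
proof (induction Q arbitrary: M rule: finite_induct)
  case empty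
  then have "M \<subseteq> {1}"
    by (auto simp: prime_factorization_empty_iff)
  then have "(\<Sum>n\<in>M. 1 / real n) \<le> (\<Sum>n\<in>{1}. 1 / real n)"
    by (intro sum_mono2) auto
  then show ?case by simp
next
  case (insert p Q)
  have p: "prime p" "1 < p" using insert.prems(1) prime_gt_1_nat by auto
  let ?R = "\<Prod>q\<in>Q. 1 / (1 - 1 / real q)"
  have R: "0 \<le> ?R"
  proof (rule prod_nonneg)
    fix q assume "q \<in> Q"
    then have "1 < q" using insert.prems(1) prime_gt_1_nat by auto
    then show "0 \<le> 1 / (1 - 1 / real q)" by simp
  qed
  define K where "K = Max (insert 0 (multiplicity p ` M))"
  have part: "(\<Sum>n | n \<in> M \<and> multiplicity p n = k. 1 / real n) \<le> (1 / real p) ^ k * ?R" for k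
  proof -
    let ?M = "{n \<in> M. multiplicity p n = k}" and ?g = "\<lambda>n. n div p ^ k"
    have n: "n = p ^ k * ?g n" if "n \<in> ?M" for n
      using that multiplicity_dvd[of p n] by auto
    have inj: "inj_on ?g ?M"
      using n by (metis (no_types, lifting) inj_onI)
    have "(\<Sum>n\<in>?M. 1 / real n) = (\<Sum>n\<in>?M. (1 / real p) ^ k * (1 / real (?g n)))"
    proof (rule sum.cong)
      fix m assume "m \<in> ?M"
      then have "real m = real p ^ k * real (?g m)"
        using n[of m] by (metis of_nat_mult of_nat_power)
      then show "1 / real m = (1 / real p) ^ k * (1 / real (?g m))"
        by (simp add: power_one_over)
    qed simp
    also have "\<dots> = (1 / real p) ^ k * (\<Sum>n\<in>?g ` ?M. 1 / real n)"
      using inj by (simp add: sum_distrib_left sum.reindex)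
    also have "(\<Sum>n\<in>?g ` ?M. 1 / real n) \<le> ?R"
    proof (rule insert.IH)
      fix m assume "m \<in> ?g ` ?M"
      then obtain n' where n': "n' \<in> ?M" "m = ?g n'" by auto
      then have m: "n' = p ^ k * m" "0 < n'" using n insert.prems(3) by auto
      then have "0 < m" by (cases m) auto
      have "\<not> p dvd m"
      proof
        assume "p dvd m"
        then have "p ^ Suc k dvd n'" using m by (simp add: mult_dvd_mono mult.commute)
        then have "Suc k \<le> multiplicity p n'"
          using m(2) p by (subst power_dvd_iff_le_multiplicity[symmetric]) auto
        then show False using n'(1) by simp
      qed
      moreover have "prime_factors m \<subseteq> prime_factors n'"
        using m by (intro dvd_prime_factors) auto
      moreover have "prime_factors n' \<subseteq> insert p Q"
        using insert.prems(3)[of n'] n' by auto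
      moreover have "p \<notin> prime_factors m"
        using \<open>\<not> p dvd m\<close> by auto
      ultimately show "0 < m \<and> prime_factors m \<subseteq> Q"
        using \<open>0 < m\<close> by blast
    qed (use insert.prems in auto)
    finally show ?thesis by (simp add: mult_left_mono)
  qed
  have "multiplicity p ` M \<subseteq> {..K}"
    using insert.prems(2) by (auto simp: K_def)
  then have "(\<Sum>n\<in>M. 1 / real n) = (\<Sum>k\<le>K. \<Sum>n | n \<in> M \<and> multiplicity p n = k. 1 / real n)"
    using insert.prems(2) by (intro sum.group[symmetric]) auto
  also have "\<dots> \<le> (\<Sum>k\<le>K. (1 / real p) ^ k * ?R)"
    by (intro sum_mono part)
  also have "\<dots> = (\<Sum>k\<le>K. (1 / real p) ^ k) * ?R"
    by (simp add: sum_distrib_right)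
  also have "\<dots> \<le> 1 / (1 - 1 / real p) * ?R"
  proof (rule mult_right_mono[OF _ R])
    have "(1 - 1 / real p) * (\<Sum>k\<le>K. (1 / real p) ^ k) = 1 - (1 / real p) ^ Suc K"
      by (rule sum_gp_basic)
    also have "\<dots> \<le> 1" by simp
    finally show "(\<Sum>k\<le>K. (1 / real p) ^ k) \<le> 1 / (1 - 1 / real p)"
      using p(2) by (simp add: field_simps)
  qed
  finally show ?case using insert.hyps by simp
qed

section \<open>Upper bound for the product of 1 - 1 / p\<close>

lemma ln_le_harmonic: "0 < n \<Longrightarrow> ln (real n) \<le> (\<Sum>k=1..<n. 1 / real k)"
proof (induction n)
  case (Suc n)
  show ?case
  proof (cases "n = 0")
    case False
    have "real (Suc n) = real n * (1 + 1 / real n)"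
      using False by (simp add: distrib_left)
    then have "ln (real (Suc n)) = ln (real n) + ln (1 + 1 / real n)"
      using False ln_mult_pos[of "real n" "1 + 1 / real n"] by (simp add: add_pos_nonneg)
    also have "\<dots> \<le> ln (real n) + 1 / real n"
      using ln_add_one_self_le_self[of "1 / real n"] by simp
    finally show ?thesis using Suc False by simp
  qed simp
qed simp

lemma prod_primes_le:
  assumes "2 \<le> y"
  shows "(\<Prod>p | prime p \<and> p < y. 1 - 1 / real p) \<le> 1 / ln (real y)"
proof -
  let ?Q = "{p :: nat. prime p \<and> p < y}"
  have "ln (real y) \<le> (\<Sum>k=1..<y. 1 / real k)"
    using assms by (intro ln_le_harmonic) simp
  also have "\<dots> \<le> (\<Prod>p\<in>?Q. 1 / (1 - 1 / real p))"
  proof (rule sum_inverse_smooth_le)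
    fix n assume n: "n \<in> {1..<y}"
    then show "0 < n \<and> prime_factors n \<subseteq> ?Q"
      by (auto dest!: dvd_imp_le)
  qed auto
  also have "\<dots> = 1 / (\<Prod>p\<in>?Q. 1 - 1 / real p)"
    by (simp add: prod_dividef)
  finally have *: "ln (real y) \<le> 1 / (\<Prod>p\<in>?Q. 1 - 1 / real p)" .
  have "0 < (\<Prod>p\<in>?Q. 1 - 1 / real p)"
    by (intro prod_pos) (auto dest: prime_gt_1_nat)
  then show ?thesis
    using * assms by (simp add: field_simps)
qed

section \<open>Lower bound for the product of 1 - 1 / p\<close>

lemma powr_minus_one_add: "0 < x \<Longrightarrow> x powr - (1 + \<delta>) = x powr - \<delta> / x" for x :: real
proof -
  assume "0 < x"
  moreover have "- (1 + \<delta>) = - \<delta> - 1" by simp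
  ultimately show ?thesis by (simp only: powr_diff powr_one less_imp_le)
qed

text \<open>Discrete version of the integral bound for zeta(1 + \<delta>): a term with
  \<open>k > 1\<close> is at most
  \<open>((k - 1) powr - \<delta> - k powr - \<delta>) / \<delta>\<close>, and these telescope. The
  inequality follows from \<open>1 + t \<le> exp t\<close> and
  \<open>ln u \<le> u - 1\<close>.\<close>

lemma sum_powr_le:
  fixes \<delta> :: real
  assumes "0 < \<delta>" and "0 < n"
  shows "(\<Sum>k=1..n. real k powr - (1 + \<delta>)) \<le> 1 + (1 - real n powr - \<delta>) / \<delta>"
  using assms(2)
proof (induction n rule: nat_induct_non_zero)
  case (Suc n)
  let ?m = "real (Suc n)"
  have "1 + \<delta> / ?m \<le> exp (\<delta> / ?m)" by (rule exp_ge_add_one_self)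
  also have "\<dots> \<le> exp (- \<delta> * ln (1 - 1 / ?m))"
  proof -
    have "ln (1 - 1 / ?m) \<le> - (1 / ?m)"
      using ln_le_minus_one[of "1 - 1 / ?m"] Suc.hyps by (simp add: field_simps)
    then have "\<delta> * (1 / ?m) \<le> \<delta> * (- ln (1 - 1 / ?m))"
      using assms(1) by (intro mult_left_mono) auto
    then show ?thesis by simp
  qed
  also have "\<dots> = (1 - 1 / ?m) powr - \<delta>"
    using Suc.hyps by (simp add: powr_def)
  finally have "?m powr - \<delta> * (1 + \<delta> / ?m) \<le> ?m powr - \<delta> * (1 - 1 / ?m) powr - \<delta>"
    by (intro mult_left_mono) auto
  also have "\<dots> = (?m * (1 - 1 / ?m)) powr - \<delta>"
    by (rule powr_mult[symmetric])
  also have "?m * (1 - 1 / ?m) = real n" by (simp add: field_simps)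
  finally have "?m powr - \<delta> * (1 + \<delta> / ?m) \<le> real n powr - \<delta>" .
  moreover have "?m powr - (1 + \<delta>) = ?m powr - \<delta> / ?m"
    by (rule powr_minus_one_add) simp
  then have "?m powr - \<delta> * (1 + \<delta> / ?m) = ?m powr - \<delta> + \<delta> * ?m powr - (1 + \<delta>)"
    by (simp add: distrib_left)
  ultimately have "?m powr - (1 + \<delta>) \<le> (real n powr - \<delta> - ?m powr - \<delta>) / \<delta>"
    using assms(1) by (subst pos_le_divide_eq) (auto simp: mult.commute)
  then show ?case using Suc.IH assms(1) by (simp add: diff_divide_distrib)
qed simp

text \<open>Weak form of Mertens's first theorem: the product of \<open>p ^ (n div p)\<close> is at
  most \<open>fact n \<le> n ^ n\<close>. After taking logarithms, the factor 2 comes from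
  \<open>n div p \<ge> n / (2 * p)\<close> for \<open>p \<le> n\<close>.\<close>

lemma sum_ln_prime_le:
  "(\<Sum>p | prime p \<and> p \<le> n. ln (real p) / real p) \<le> 2 * ln (real n)"
proof (cases "n = 0")
  case False
  let ?Q = "{p :: nat. prime p \<and> p \<le> n}"
  have Q: "?Q = prime_factors (fact n)"
    unfolding prime_factors_fact by (auto dest: prime_ge_2_nat)
  have "(\<Prod>p\<in>?Q. p ^ (n div p)) \<le> (\<Prod>p\<in>?Q. p ^ multiplicity p (fact n))"
  proof (intro prod_mono conjI power_increasing)
    fix p assume p: "p \<in> ?Q"
    then show "1 \<le> p" using prime_ge_1_nat by auto
    have "n div p ^ 1 \<le> (\<Sum>k=1..n. n div p ^ k)"
      using False by (intro member_le_sum) auto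
    then show "n div p \<le> multiplicity p (fact n)"
      using p multiplicity_fact[of p n n] by simp
  qed auto
  also have "\<dots> = fact n"
    unfolding Q by (rule prime_factorization_nat[symmetric]) simp
  also have "\<dots> \<le> n ^ n" using fact_le_power[of n, where 'a = nat] by simp
  finally have "real (\<Prod>p\<in>?Q. p ^ (n div p)) \<le> real (n ^ n)" by (rule of_nat_mono)
  moreover have "0 < (\<Prod>p\<in>?Q. p ^ (n div p))"
    by (intro prod_pos) (auto dest: prime_gt_0_nat)
  then have "0 < real (\<Prod>p\<in>?Q. p ^ (n div p))"
    by (simp only: of_nat_0_less_iff)
  ultimately have "ln (real (\<Prod>p\<in>?Q. p ^ (n div p))) \<le> ln (real (n ^ n))"
    by (intro ln_mono) auto
  also have "ln (real (n ^ n)) = real n * ln (real n)"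
    using False by (simp add: ln_realpow)
  also have "ln (real (\<Prod>p\<in>?Q. p ^ (n div p))) = (\<Sum>p\<in>?Q. ln (real (p ^ (n div p))))"
    unfolding of_nat_prod by (rule ln_prod) (auto dest: prime_gt_0_nat)
  also have "\<dots> = (\<Sum>p\<in>?Q. real (n div p) * ln (real p))"
    by (intro sum.cong) (auto simp: ln_realpow prime_gt_0_nat)
  finally have "(\<Sum>p\<in>?Q. real (n div p) * ln (real p)) \<le> real n * ln (real n)" .
  moreover have "(\<Sum>p\<in>?Q. real n / 2 * (ln (real p) / real p)) \<le> (\<Sum>p\<in>?Q. real (n div p) * ln (real
      p))"
  proof (rule sum_mono)
    fix p assume p: "p \<in> ?Q"
    then have "0 < p" "p \<le> n" by (auto dest: prime_gt_0_nat)
    then have "1 \<le> n div p" by (simp add: div_greater_zero_iff Suc_le_eq)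
    have "n < p * (n div p) + p"
      using \<open>0 < p\<close> by (metis add.commute add_less_cancel_left div_mult_mod_eq mod_less_divisor
          mult.commute)
    also have "\<dots> \<le> p * (n div p) + p * (n div p)"
      using \<open>1 \<le> n div p\<close> by simp
    finally have "real n < real (2 * (p * (n div p)))" by (subst of_nat_less_iff) simp
    then have "real n / 2 / real p \<le> real (n div p)"
      using \<open>0 < p\<close> by (simp add: field_simps)
    then have "real n / 2 / real p * ln (real p) \<le> real (n div p) * ln (real p)"
      using \<open>0 < p\<close> by (intro mult_right_mono) auto
    then show "real n / 2 * (ln (real p) / real p) \<le> real (n div p) * ln (real p)" by simp
  qed
  ultimately have "real n / 2 * (\<Sum>p\<in>?Q. ln (real p) / real p) \<le> real n * ln (real n)"
    by (simp add: sum_distrib_left)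
  then show ?thesis using False by (simp add: field_simps)
qed simp


text \<open>Multiplied out, the product is a sum over sets of primes. By unique factorization the
  products of these sets are distinct integers, so the sum is part of the one bounded in
  \<open>sum_powr_le\<close>.\<close>

lemma prod_one_plus_powr_le:
  fixes \<delta> :: real
  assumes "0 < \<delta>"
  shows "(\<Prod>p | prime p \<and> p \<le> n. 1 + real p powr - (1 + \<delta>)) \<le> 1 + 1 / \<delta>"
proof -
  let ?Q = "{p :: nat. prime p \<and> p \<le> n}" and ?f = "\<lambda>k. real k powr - (1 + \<delta>)"
  define N where "N = \<Prod>?Q"
  have N: "0 < N" unfolding N_def by (intro prod_pos) (auto dest: prime_gt_0_nat)
  have inj: "inj_on Prod (Pow ?Q)"
  proof (rule inj_onI)
    fix A B assume AB: "A \<in> Pow ?Q" "B \<in> Pow ?Q" "\<Prod>A = \<Prod>B"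
    have pf: "prime_factors (\<Prod>A) = A" if "A \<in> Pow ?Q" for A
    proof -
      have "finite A" using that finite_subset[of A ?Q] by auto
      moreover have "0 \<notin> (\<lambda>x. x) ` A" using that by (auto dest: prime_gt_0_nat)
      ultimately have "prime_factors (\<Prod>A) = (\<Union>p\<in>A. prime_factors p)"
        using prime_factors_prod[of A "\<lambda>x. x"] by simp
      also have "\<dots> = (\<Union>p\<in>A. {p})"
        using that by (intro SUP_cong) (auto simp: prime_factorization_prime)
      finally show ?thesis by simp
    qed
    show "A = B" using AB pf by metis
  qed
  have "(\<Prod>p\<in>?Q. ?f p + 1) = (\<Sum>A\<in>Pow ?Q. (\<Prod>p\<in>A. ?f p) * (\<Prod>p\<in>?Q - A. 1))"
    by (rule prod_add) simp
  also have "\<dots> = (\<Sum>A\<in>Pow ?Q. ?f (\<Prod>A))"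
  proof (rule sum.cong)
    fix A assume "A \<in> Pow ?Q"
    have "(\<Prod>p\<in>A. ?f p) = (\<Prod>p\<in>A. real p) powr - (1 + \<delta>)"
      by (induction A rule: infinite_finite_induct) (auto simp: powr_mult prod_nonneg)
    then show "(\<Prod>p\<in>A. ?f p) * (\<Prod>p\<in>?Q - A. 1) = ?f (\<Prod>A)" by simp
  qed simp
  also have "\<dots> = (\<Sum>k\<in>Prod ` Pow ?Q. ?f k)"
    using inj by (simp add: sum.reindex)
  also have "\<dots> \<le> (\<Sum>k=1..N. ?f k)"
  proof (rule sum_mono2)
    show "Prod ` Pow ?Q \<subseteq> {1..N}"
    proof (rule image_subsetI)
      fix A assume A: "A \<in> Pow ?Q"
      have "\<Prod>A dvd N" unfolding N_def using A by (intro prod_dvd_prod_subset) auto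
      then show "\<Prod>A \<in> {1..N}" using N by (auto dest: dvd_imp_le intro!: Nat.gr0I simp: Suc_le_eq)
    qed
  qed auto
  also have "\<dots> \<le> 1 + (1 - real N powr - \<delta>) / \<delta>"
    using assms N by (rule sum_powr_le)
  also have "\<dots> \<le> 1 + 1 / \<delta>"
    using assms by (simp add: divide_right_mono)
  finally show ?thesis by (simp add: add.commute)
qed

text \<open>Replacing \<open>1 / p\<close> by \<open>p powr - (1 + \<delta>)\<close> costs a factor
  \<open>exp (\<delta> * ln p / p)\<close> per prime. For \<open>\<delta> = 1 / ln n\<close> these
  factors multiply to at most \<open>exp 2\<close> by \<open>sum_ln_prime_le\<close>, and
  \<open>1 + 1 / \<delta>\<close> is \<open>1 + ln n\<close>.\<close>

lemma prod_one_plus_inverse_le: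
  assumes "2 \<le> n"
  shows "(\<Prod>p | prime p \<and> p \<le> n. 1 + 1 / real p) \<le> exp 2 * (1 + ln (real n))"
proof -
  let ?Q = "{p :: nat. prime p \<and> p \<le> n}"
  define \<delta> where "\<delta> = 1 / ln (real n)"
  have ln: "0 < ln (real n)" using assms by simp
  have \<delta>: "0 < \<delta>" using ln by (simp add: \<delta>_def)
  have "(\<Prod>p\<in>?Q. 1 + 1 / real p) \<le>
      (\<Prod>p\<in>?Q. (1 + real p powr - (1 + \<delta>)) * exp (\<delta> * (ln (real p) / real p)))"
  proof (intro prod_mono conjI)
    fix p assume "p \<in> ?Q"
    then have p: "1 < real p" by (auto dest: prime_gt_1_nat)
    let ?b = "real p powr - (1 + \<delta>)"
    have "1 - \<delta> * ln (real p) \<le> exp (- \<delta> * ln (real p))"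
      using exp_ge_add_one_self[of "- \<delta> * ln (real p)"] by simp
    also have "\<dots> = real p powr - \<delta>" using p by (simp add: powr_def)
    finally have "(1 - \<delta> * ln (real p)) / real p \<le> real p powr - \<delta> / real p"
      using p by (intro divide_right_mono) auto
    also have "\<dots> = ?b" using p by (intro powr_minus_one_add[symmetric]) simp
    finally have "1 / real p - ?b \<le> \<delta> * (ln (real p) / real p)"
      by (simp add: diff_divide_distrib)
    have "0 \<le> ?b * (\<delta> * (ln (real p) / real p))" using \<delta> p by simp
    with \<open>1 / real p - ?b \<le> \<delta> * (ln (real p) / real p)\<close>
    have "1 + 1 / real p \<le> (1 + ?b) * (1 + \<delta> * (ln (real p) / real p))"
      by (simp add: algebra_simps)
    also have "\<dots> \<le> (1 + ?b) * exp (\<delta> * (ln (real p) / real p))"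
      by (intro mult_left_mono exp_ge_add_one_self) (simp add: add_nonneg_nonneg)
    finally show "1 + 1 / real p \<le> (1 + ?b) * exp (\<delta> * (ln (real p) / real p))" .
  qed auto
  also have "\<dots> = (\<Prod>p\<in>?Q. 1 + real p powr - (1 + \<delta>)) * exp (\<delta> * (\<Sum>p\<in>?Q. ln (real p) / real p))"
    by (simp add: prod.distrib exp_sum sum_distrib_left)
  also have "\<dots> \<le> (1 + 1 / \<delta>) * exp 2"
  proof (rule mult_mono)
    show "(\<Prod>p\<in>?Q. 1 + real p powr - (1 + \<delta>)) \<le> 1 + 1 / \<delta>"
      by (rule prod_one_plus_powr_le[OF \<delta>])
    have "\<delta> * (\<Sum>p\<in>?Q. ln (real p) / real p) \<le> \<delta> * (2 * ln (real n))"
      using \<delta> by (intro mult_left_mono sum_ln_prime_le) auto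
    also have "\<dots> = 2" using ln by (simp add: \<delta>_def)
    finally show "exp (\<delta> * (\<Sum>p\<in>?Q. ln (real p) / real p)) \<le> exp 2" by simp
  qed (use \<delta> in auto)
  finally show ?thesis by (simp add: \<delta>_def mult.commute)
qed

text \<open>Over all \<open>k\<close> from 2 to \<open>n\<close> the product telescopes to
  \<open>(n + 1) / (2 * n)\<close>; removing the composite factors, each at most 1, cannot decrease
  it.\<close>

lemma prod_one_minus_square_ge: "1 / 2 \<le> (\<Prod>p | prime p \<and> p \<le> n. 1 - 1 / (real p)\<^sup>2)"
proof (cases "2 \<le> n")
  case True
  have "(\<Prod>k=2..n. 1 - 1 / (real k)\<^sup>2) = (real n + 1) / (2 * real n)"
    using True
  proof (induction n rule: dec_induct)
    case (step m)
    then have "(\<Prod>k=2..Suc m. 1 - 1 / (real k)\<^sup>2) =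
        (real m + 1) / (2 * real m) * (1 - 1 / (real (Suc m))\<^sup>2)" by simp
    also have "1 - 1 / (real (Suc m))\<^sup>2 = real m * (real m + 2) / (real (Suc m) * real (Suc m))"
      by (simp add: divide_simps power2_eq_square) (simp add: algebra_simps)
    also have "(real m + 1) / (2 * real m) * \<dots> = (real (Suc m) + 1) / (2 * real (Suc m))"
      using step.hyps by (simp add: divide_simps) (simp add: algebra_simps)
    finally show ?case .
  qed (simp add: power2_eq_square)
  also have "1 / 2 \<le> (real n + 1) / (2 * real n)" using True by (simp add: field_simps)
  finally have "1 / 2 \<le> (\<Prod>k=2..n. 1 - 1 / (real k)\<^sup>2)" .
  also have "\<dots> \<le> (\<Prod>p | prime p \<and> p \<le> n. 1 - 1 / (real p)\<^sup>2)"
  proof -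
    have sub: "{p. prime p \<and> p \<le> n} \<subseteq> {2..n}" by (auto dest: prime_ge_2_nat)
    have fac: "0 \<le> 1 - 1 / (real k)\<^sup>2 \<and> 1 - 1 / (real k)\<^sup>2 \<le> 1" if "k \<in> {2..n}" for k
      using that by (simp add: power2_eq_square field_simps mult_mono flip: of_nat_mult)
    have "(\<Prod>k=2..n. 1 - 1 / (real k)\<^sup>2) = (\<Prod>p | prime p \<and> p \<le> n. 1 - 1 / (real p)\<^sup>2) *
        (\<Prod>k\<in>{2..n} - {p. prime p \<and> p \<le> n}. 1 - 1 / (real k)\<^sup>2)"
      using prod.subset_diff[OF sub] by (simp add: mult.commute)
    also have "\<dots> \<le> (\<Prod>p | prime p \<and> p \<le> n. 1 - 1 / (real p)\<^sup>2) * 1"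
    proof (intro mult_left_mono prod_nonneg prod_le_1)
      show "0 \<le> 1 - 1 / (real p)\<^sup>2" if "p \<in> {p. prime p \<and> p \<le> n}" for p
        using fac[of p] sub that by blast
    qed (use fac in auto)
    finally show ?thesis by simp
  qed
  finally show ?thesis .
next
  case False
  then have empty: "{p. prime p \<and> p \<le> n} = {}" by (auto dest: prime_ge_2_nat)
  show ?thesis unfolding empty by simp
qed

lemma prod_primes_ge:
  assumes "2 \<le> n"
  shows "exp (- 2) / (2 * (1 + ln (real n))) \<le> (\<Prod>p | prime p \<and> p \<le> n. 1 - 1 / real p)"
proof -
  let ?Q = "{p :: nat. prime p \<and> p \<le> n}"
  let ?P = "\<Prod>p\<in>?Q. 1 - 1 / real p" and ?R = "\<Prod>p\<in>?Q. 1 + 1 / real p"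
  have ln: "0 < ln (real n)" using assms by simp
  have P: "0 \<le> ?P" by (intro prod_nonneg) (auto dest: prime_gt_1_nat)
  have "1 / 2 \<le> (\<Prod>p\<in>?Q. 1 - 1 / (real p)\<^sup>2)" by (rule prod_one_minus_square_ge)
  \<comment> \<open>As \<open>(1 - 1 / p) * (1 + 1 / p) = 1 - 1 / p ^ 2\<close>, an upper bound for
    \<open>?R\<close> becomes a lower bound for \<open>?P\<close>.\<close>
  also have "\<dots> = ?P * ?R"
    unfolding prod.distrib[symmetric]
    by (intro prod.cong) (auto simp: algebra_simps power2_eq_square)
  also have "\<dots> \<le> ?P * (exp 2 * (1 + ln (real n)))"
    using P prod_one_plus_inverse_le[OF assms] by (intro mult_left_mono)
  finally have "1 / 2 / (exp 2 * (1 + ln (real n))) \<le> ?P"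
    using ln by (subst pos_divide_le_eq) auto
  then show ?thesis
    by (simp add: exp_minus inverse_eq_divide algebra_simps)
qed

section \<open>From prime products to the totient ratio\<close>

lemma totient_ratio: "0 < m \<Longrightarrow> real (totient m) / real m = (\<Prod>p\<in>prime_factors m. 1 - 1 / real p)"
  by (simp add: totient_formula2)

text \<open>Prime factors up to \<open>L\<close> are controlled by \<open>prod_primes_ge\<close>. At
  most \<open>L\<close> prime factors exceed \<open>L\<close>, because \<open>m < 2 ^ L\<close>, and
  each contributes a factor of at least \<open>exp (- 2 / L)\<close>, together at least
  \<open>exp (- 2)\<close>.\<close>

lemma totient_ratio_ge:
  assumes "0 < m" and "m < 2 ^ L" and "2 \<le> L"
  shows "exp (- 4) / (2 * (1 + ln (real L))) \<le> real (totient m) / real m"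
proof -
  let ?A = "{p \<in> prime_factors m. p \<le> L}" and ?B = "{p \<in> prime_factors m. L < p}"
  let ?Q = "{p :: nat. prime p \<and> p \<le> L}"
  let ?f = "\<lambda>p :: nat. 1 - 1 / real p"
  have f: "0 \<le> ?f p" "?f p \<le> 1" if "prime p" for p
    using prime_gt_1_nat[OF that] by auto
  have "exp (- 2) / (2 * (1 + ln (real L))) \<le> (\<Prod>p\<in>?Q. ?f p)"
    using assms(3) by (rule prod_primes_ge)
  also have "(\<Prod>p\<in>?Q. ?f p) \<le> (\<Prod>p\<in>?A. ?f p)"
  proof -
    have "(\<Prod>p\<in>?Q. ?f p) = (\<Prod>p\<in>?A. ?f p) * (\<Prod>p\<in>?Q - ?A. ?f p)"
      using prod.subset_diff[of ?A ?Q] by (auto simp: mult.commute)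
    also have "\<dots> \<le> (\<Prod>p\<in>?A. ?f p) * 1"
      using f by (intro mult_left_mono prod_nonneg prod_le_1) auto
    finally show ?thesis by simp
  qed
  finally have A: "exp (- 2) / (2 * (1 + ln (real L))) \<le> (\<Prod>p\<in>?A. ?f p)" .
  have "card ?B \<le> L"
  proof -
    have "2 ^ card ?B = (\<Prod>p\<in>?B. 2 :: nat)" by simp
    also have "\<dots> \<le> \<Prod>?B" using assms(3) by (intro prod_mono) auto
    also have "\<Prod>?B dvd m" by (rule prod_primes_dvd) auto
    then have "\<Prod>?B \<le> m" using assms(1) by (rule dvd_imp_le)
    also have "m < 2 ^ L" by fact
    finally show ?thesis by simp
  qed
  have "exp (- 2) \<le> (\<Prod>p\<in>?B. exp (- 2 / real L))"
  proof -
    have "(\<Prod>p\<in>?B. exp (- 2 / real L)) = exp (- 2 / real L * real (card ?B))"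
      by (simp add: exp_of_nat_mult[symmetric] mult.commute)
    moreover have "2 / real L * real (card ?B) \<le> 2 / real L * real L"
      using \<open>card ?B \<le> L\<close> by (intro mult_left_mono) auto
    then have "2 / real L * real (card ?B) \<le> 2" using assms(3) by simp
    ultimately show ?thesis by simp
  qed
  also have "\<dots> \<le> (\<Prod>p\<in>?B. ?f p)"
  proof (intro prod_mono conjI)
    fix p assume "p \<in> ?B"
    then have p: "2 \<le> p" "L < p" using assms(3) by auto
    have "- (2 / real L) \<le> - (2 / real p)"
      using p assms(3) by (simp add: frac_le)
    \<comment> \<open>With \<open>u = 1 / p \<le> 1 / 2\<close> one has
      \<open>2 * u ^ 2 \<le> u\<close>, and \<open>- u - 2 * u ^ 2\<close> is a lower bound for
      \<open>ln (1 - u)\<close>.\<close>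
    also have "\<dots> \<le> - (1 / real p) - 2 * (1 / real p)\<^sup>2"
      using p by (simp add: field_simps power2_eq_square)
    also have "\<dots> \<le> ln (?f p)"
      using p by (intro ln_one_minus_pos_lower_bound) (auto simp: field_simps)
    finally have "exp (- 2 / real L) \<le> exp (ln (?f p))" by simp
    also have "\<dots> = ?f p" using p by (intro exp_ln) simp
    finally show "exp (- 2 / real L) \<le> ?f p" .
  qed auto
  finally have B: "exp (- 2) \<le> (\<Prod>p\<in>?B. ?f p)" .
  have "exp (- 4) / (2 * (1 + ln (real L))) = exp (- 2) / (2 * (1 + ln (real L))) * exp (- 2)"
    by (simp flip: exp_add)
  also have "\<dots> \<le> (\<Prod>p\<in>?A. ?f p) * (\<Prod>p\<in>?B. ?f p)"
    using A B f by (intro mult_mono prod_nonneg) auto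
  also have "\<dots> = (\<Prod>p\<in>?A \<union> ?B. ?f p)"
    by (rule prod.union_disjoint[symmetric]) auto
  also have "?A \<union> ?B = prime_factors m" by auto
  also have "(\<Prod>p\<in>prime_factors m. ?f p) = real (totient m) / real m"
    using assms(1) by (rule totient_ratio[symmetric])
  finally show ?thesis .
qed

lemma totient_ratio_le:
  assumes "0 < m" and "2 \<le> y" and "\<And>p. prime p \<Longrightarrow> p < y \<Longrightarrow> p dvd m"
  shows "real (totient m) / real m \<le> 1 / ln (real y)"
proof -
  let ?Q = "{p :: nat. prime p \<and> p < y}" and ?f = "\<lambda>p :: nat. 1 - 1 / real p"
  have f: "0 \<le> ?f p" "?f p \<le> 1" if "prime p" for p
    using prime_gt_1_nat[OF that] by auto
  have sub: "?Q \<subseteq> prime_factors m"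
    using assms by (auto simp: prime_factors_dvd)
  have "real (totient m) / real m = (\<Prod>p\<in>prime_factors m. ?f p)"
    using assms(1) by (rule totient_ratio)
  also have "\<dots> = (\<Prod>p\<in>?Q. ?f p) * (\<Prod>p\<in>prime_factors m - ?Q. ?f p)"
    using prod.subset_diff[OF sub] by (simp add: mult.commute)
  also have "\<dots> \<le> (\<Prod>p\<in>?Q. ?f p) * 1"
    using f by (intro mult_left_mono prod_nonneg prod_le_1) auto
  also have "\<dots> \<le> 1 / ln (real y)"
    using prod_primes_le[OF assms(2)] by simp
  finally show ?thesis .
qed

section \<open>The output and its properties\<close>

lemma bitlen_less_iff: "0 < L \<Longrightarrow> bitlen n < L \<longleftrightarrow> n < 2 ^ (L - 1)"
  using bitlen_le_iff[of n "L - 1"] by auto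

lemma le_bitlen_iff: "0 < L \<Longrightarrow> L \<le> bitlen n \<longleftrightarrow> 2 ^ (L - 1) \<le> n"
  using bitlen_less_iff[of L n] by linarith

definition last_prime :: "nat \<Rightarrow> nat" where
  "last_prime L = (LEAST q. prime q \<and> L \<le> bitlen (q * acc L q))"

definition result :: "nat \<Rightarrow> nat" where
  "result L = last_prime L * acc L (last_prime L)"

lemma last_prime:
  shows "prime (last_prime L)" and "L \<le> bitlen (result L)"
    and "\<And>p. prime p \<Longrightarrow> p < last_prime L \<Longrightarrow> bitlen (p * acc L p) < L"
proof -
  obtain q :: nat where q: "prime q" "2 ^ L < q" using bigger_prime by blast
  have "2 ^ L \<le> q * acc L q"
    using q(2) mult_le_mono2[of 1 "acc L q" q] acc_pos[of L q] by linarith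
  then have "L \<le> bitlen (q * acc L q)" using less_bitlen_iff by (simp add: less_imp_le)
  with q(1) have ex: "prime q \<and> L \<le> bitlen (q * acc L q)" by simp
  show "prime (last_prime L)" "L \<le> bitlen (result L)"
    unfolding result_def last_prime_def
    using LeastI[of "\<lambda>q. prime q \<and> L \<le> bitlen (q * acc L q)", OF ex] by auto
  show "bitlen (p * acc L p) < L" if "prime p" "p < last_prime L" for p
    using not_less_Least[of p "\<lambda>q. prime q \<and> L \<le> bitlen (q * acc L q)"] that
    unfolding last_prime_def by auto
qed

text \<open>Up to the prime \<open>y\<close> the accumulator is the full primorial, from
  \<open>y\<close> on it is constant, so the output is \<open>q * primorial y\<close> with
  \<open>q \<ge> y\<close>. Bertrand's postulate, in the form \<open>pred\<close>, keeps it below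
  twice \<open>2 ^ (L - 1)\<close>.\<close>

lemma result_facts:
  assumes prime_between: "\<And>n. N \<le> n \<Longrightarrow> \<exists>p. prime p \<and> n < p \<and> p \<le> 2 * n"
    and primorial_ge: "2 ^ L \<le> primorial (2 * L ^ 2 + 1)"
    and large: "8 * N + 20 < L"
  shows "bitlen (result L) = L"
    and "\<exists>S. finite S \<and> (\<forall>p\<in>S. prime p) \<and> result L = \<Prod>S"
    and "\<exists>y. L \<le> 4 * y + 1 \<and> (\<forall>p. prime p \<longrightarrow> p < y \<longrightarrow> p dvd result L)"
    and "last_prime L \<le> 32 * L ^ 4"
proof -
  have "0 < L" using large by simp
  have two_pow: "(2::nat) ^ L = 2 * 2 ^ (L - 1)"
    using \<open>0 < L\<close> by (simp flip: power_Suc)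
  have pred: "\<exists>r. prime r \<and> r < q \<and> q \<le> 2 * r" if "2 * N + 1 < q" for q
  proof -
    have "N \<le> (q - 1) div 2" using that by simp
    then obtain r where r: "prime r" "(q - 1) div 2 < r" "r \<le> 2 * ((q - 1) div 2)"
      using prime_between by blast
    then have "r < q \<and> q \<le> 2 * r" using that by linarith
    then show ?thesis using r(1) by blast
  qed
  \<comment> \<open>The inequality negates the room test in \<open>acc\<close> at a moment when all
    smaller primes have been absorbed; \<open>y\<close> is thus the first rejected prime.\<close>
  let ?Y = "\<lambda>y. prime y \<and> 2 ^ (L - 1) \<le> primorial y * y ^ 2"
  define y where "y = (LEAST y. ?Y y)"
  obtain y0 :: nat where y0: "prime y0" "2 ^ (L - 1) < y0" using bigger_prime by blast
  have "2 ^ (L - 1) \<le> primorial y0 * y0 ^ 2"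
  proof -
    have "y0 * 1 \<le> y0 * y0" using y0 by (intro mult_le_mono) auto
    then have "1 * y0 \<le> primorial y0 * y0 ^ 2"
      using primorial_pos[of y0] by (intro mult_le_mono) (auto simp: power2_eq_square Suc_le_eq)
    then show ?thesis using y0 by linarith
  qed
  then have "?Y y" unfolding y_def using y0(1) by (intro LeastI[of ?Y y0]) simp
  then have y: "prime y" "2 ^ (L - 1) \<le> primorial y * y ^ 2" by auto
  have y_min: "primorial r * r ^ 2 < 2 ^ (L - 1)" if "prime r" "r < y" for r
    using not_less_Least[of r ?Y] that unfolding y_def by auto
  have L_le: "L \<le> 4 * y + 1"
  proof -
    have "primorial y \<le> 4 ^ (y - 1)"
      using primorial_le[of "y - 1"] prime_gt_0_nat[OF y(1)] by simp
    also have "\<dots> \<le> 4 ^ y" by (intro power_increasing) auto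
    finally have "primorial y * y ^ 2 \<le> 4 ^ y * (2 ^ y) ^ 2"
      using less_exp[of y] by (intro mult_le_mono power_mono) auto
    also have "\<dots> = 2 ^ (4 * y)"
      by (simp add: power2_eq_square power_mult flip: power_mult_distrib)
    finally have "(2::nat) ^ (L - 1) \<le> 2 ^ (4 * y)" using y(2) by linarith
    then have "L - 1 \<le> 4 * y" by simp
    then show ?thesis by simp
  qed
  have y_large: "2 * N + 1 < y" using L_le large by linarith
  have acc1: "acc L p = primorial p" if "p \<le> y" for p
    using that
  proof (induction p)
    case (Suc p)
    then have "acc L p = primorial p" by simp
    moreover have "bitlen (p * (p * primorial p)) < L" if "prime p"
      using y_min[OF that] Suc.prems \<open>0 < L\<close>
      by (simp add: bitlen_less_iff power2_eq_square ac_simps)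
    ultimately show ?case by (auto simp: primorial_Suc)
  qed simp
  have acc2: "acc L p = primorial y" if "y \<le> p" for p
    using that
  proof (induction p rule: dec_induct)
    case (step p)
    have "primorial y * (y * y) \<le> primorial y * (p * p)"
      using step.hyps by (intro mult_le_mono) auto
    with y(2) have "2 ^ (L - 1) \<le> primorial y * (p * p)"
      unfolding power2_eq_square by (rule order_trans)
    then have "2 ^ (L - 1) \<le> p * (p * primorial y)"
      by (simp only: ac_simps)
    then have "\<not> bitlen (p * (p * primorial y)) < L"
      using \<open>0 < L\<close> by (simp add: bitlen_less_iff)
    then show ?case using step.IH by simp
  qed (simp add: acc1)
  define q where "q = last_prime L"
  have q: "prime q" "2 ^ (L - 1) \<le> result L"
    using last_prime[of L] \<open>0 < L\<close> by (auto simp: q_def le_bitlen_iff)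
  have q_min: "p * primorial y < 2 ^ (L - 1)" if "prime p" "y \<le> p" "p < q" for p
    using last_prime(3)[of p L] that \<open>0 < L\<close> by (simp add: q_def bitlen_less_iff acc2)
  have "y \<le> q"
  proof (rule ccontr)
    assume "\<not> y \<le> q"
    then have "q < y" by simp
    then have "result L = primorial q * q"
      using acc1[of q] by (simp add: result_def q_def)
    also have "\<dots> \<le> primorial q * q ^ 2"
      using prime_gt_0_nat[OF q(1)] by (simp add: power2_eq_square)
    also have "\<dots> < 2 ^ (L - 1)" using y_min[OF q(1) \<open>q < y\<close>] .
    finally show False using q(2) by simp
  qed
  then have result: "result L = q * primorial y"
    using acc2[of q] by (simp add: result_def q_def)
  \<comment> \<open>If \<open>q = y\<close>, the minimality of \<open>y\<close> is applied to the
    largest prime \<open>r < y\<close>, with \<open>primorial y = r * primorial r\<close> and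
    \<open>y \<le> 2 * r\<close>. If \<open>q > y\<close>, the prime \<open>max r y\<close> did not
    stop the search; the maximum is needed since \<open>r\<close> may lie below \<open>y\<close>,
    where the accumulator was smaller.\<close>
  have "result L < 2 ^ L"
  proof (cases "q = y")
    case True
    let ?R = "{r. prime r \<and> r < y}"
    define r where "r = Max ?R"
    obtain r' where r': "prime r'" "r' < y" "y \<le> 2 * r'" using pred[OF y_large] by blast
    then have "r \<in> ?R" unfolding r_def by (intro Max_in) auto
    have "r' \<le> r" unfolding r_def using r' by (intro Max_ge) auto
    have "?R = {p. prime p \<and> p < Suc r}"
      using \<open>r \<in> ?R\<close> Max_ge[of ?R] by (auto simp: r_def less_Suc_eq_le)
    then have "primorial y = r * primorial r"
      using \<open>r \<in> ?R\<close> primorial_Suc[of r] by (simp add: primorial_def)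
    then have "result L = y * (r * primorial r)" using result True by simp
    also have "\<dots> \<le> (2 * r) * (r * primorial r)"
      using r' \<open>r' \<le> r\<close> by (intro mult_le_mono) auto
    also have "\<dots> = 2 * (primorial r * r ^ 2)" by (simp add: power2_eq_square)
    also have "\<dots> < 2 ^ L"
      using y_min[of r] \<open>r \<in> ?R\<close> two_pow by simp
    finally show ?thesis .
  next
    case False
    with \<open>y \<le> q\<close> have "y < q" by simp
    obtain r where r: "prime r" "r < q" "q \<le> 2 * r" using pred[of q] y_large \<open>y < q\<close> by auto
    have "prime (max r y)" "y \<le> max r y" "max r y < q"
      using r y(1) \<open>y < q\<close> by (auto simp: max_def)
    then have "max r y * primorial y < 2 ^ (L - 1)" by (rule q_min)
    moreover have "result L \<le> 2 * (max r y * primorial y)"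
      unfolding result mult.assoc[symmetric] using r by (intro mult_le_mono) auto
    ultimately show ?thesis using two_pow by linarith
  qed
  then have "bitlen (result L) \<le> L" by (simp add: bitlen_le_iff)
  then show "bitlen (result L) = L" using last_prime(2)[of L] by simp
  show "\<exists>S. finite S \<and> (\<forall>p\<in>S. prime p) \<and> result L = \<Prod>S"
    using q(1) \<open>y \<le> q\<close> by (intro exI[of _ "insert q {p. prime p \<and> p < y}"])
      (auto simp: result primorial_def)
  show "\<exists>y. L \<le> 4 * y + 1 \<and> (\<forall>p. prime p \<longrightarrow> p < y \<longrightarrow> p dvd result L)"
  proof (intro exI conjI allI impI)
    show "p dvd result L" if "prime p" "p < y" for p
      unfolding result primorial_def using that
      by (intro dvd_mult dvd_prodI[where f = "\<lambda>x. x", simplified]) auto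
  qed (rule L_le)
  \<comment> \<open>A prime \<open>r < y\<close> with \<open>y \<le> 2 * r\<close> has
    \<open>primorial r < 2 ^ L\<close>, so \<open>r \<le> 2 * L ^ 2\<close> and
    \<open>y \<le> 4 * L ^ 2\<close>. Comparing \<open>q * primorial y < 2 ^ L\<close> with the
    choice of \<open>y\<close> gives \<open>q \<le> 2 * y ^ 2\<close>.\<close>
  show "last_prime L \<le> 32 * L ^ 4"
  proof -
    obtain r where r: "prime r" "r < y" "y \<le> 2 * r" using pred[OF y_large] by blast
    have "primorial r * 1 \<le> primorial r * r ^ 2"
      using prime_gt_0_nat[OF r(1)] by (intro mult_le_mono) auto
    then have "primorial r < 2 ^ (L - 1)" using y_min[OF r(1,2)] by linarith
    then have "primorial r < primorial (2 * L ^ 2 + 1)" using primorial_ge two_pow by linarith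
    then have "r < 2 * L ^ 2 + 1"
      using primorial_mono[of "2 * L ^ 2 + 1" r] by (meson not_le)
    then have "y \<le> 4 * L ^ 2" using r(3) by linarith
    have "q * primorial y < 2 * (primorial y * y ^ 2)"
      using \<open>result L < 2 ^ L\<close> y(2) two_pow unfolding result by linarith
    then have "primorial y * q < primorial y * (2 * y ^ 2)" by (simp add: ac_simps)
    then have "q \<le> 2 * y ^ 2" by simp
    also have "\<dots> \<le> 2 * (4 * L ^ 2) ^ 2"
      using \<open>y \<le> 4 * L ^ 2\<close> by (intro mult_le_mono power_mono) auto
    also have "\<dots> = 32 * L ^ 4" by (simp add: power_mult_distrib flip: power_mult)
    finally show ?thesis by (simp add: q_def)
  qed
qed

lemma filterlim_bitlen: "filterlim bitlen at_top at_top"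
  unfolding filterlim_at_top
proof
  fix k
  show "\<forall>\<^sub>F n in at_top. k \<le> bitlen n"
    using eventually_ge_at_top[of "2 ^ k"]
    by eventually_elim (use less_bitlen_iff[of k] in \<open>auto simp: less_imp_le\<close>)
qed

lemma eventually_result_facts:
  "\<forall>\<^sub>F L in at_top. bitlen (result L) = L \<and>
    (\<exists>S. finite S \<and> (\<forall>p\<in>S. prime p) \<and> result L = \<Prod>S) \<and>
    (\<exists>y. L \<le> 4 * y + 1 \<and> (\<forall>p. prime p \<longrightarrow> p < y \<longrightarrow> p dvd result L)) \<and>
    last_prime L \<le> 32 * L ^ 4"
proof -
  obtain N :: nat where N: "\<And>n. N \<le> n \<Longrightarrow> \<exists>p. prime p \<and> n < p \<and> p \<le> 2 * n"
    using eventually_prime_between unfolding eventually_at_top_linorder by blast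
  show ?thesis
    using eventually_primorial_ge eventually_gt_at_top[of "8 * N + 20"]
  proof eventually_elim
    case (elim L)
    show ?case
      using result_facts[OF N elim] by blast
  qed
qed

section \<open>The machine and its running time\<close>

abbreviation machine :: tm where
  "machine \<equiv> tm_of (Suc 6) 3 greedy"

lemma wf_machine: "wf_com (Suc 6) 3 greedy"
  using wf_greedy by simp

text \<open>The output claim has a length condition because tape 6 is aligned with the right end of
  the input: only a number of exactly \<open>L\<close> digits starts at cell
  \<open>0\<close>.\<close>

lemma machine_outcome:
  assumes "0 < x"
  defines "L \<equiv> bitlen x" and "q \<equiv> last_prime (bitlen x)"
  shows "halts machine x"
    and "run_time machine x \<le> 4 * L + 21 + q * Suc (round_time q (bitlen (q * result L)))"
    and "bitlen (result L) = L \<Longrightarrow> outputs machine x (result L)"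
proof -
  have "0 < bitlen x" using assms(1) less_bitlen_iff[of 0 x] by simp
  have "\<exists>s'. runs greedy (start x) (4 * L + 21 + q * Suc (round_time q (bitlen (q * result L))))
      s' \<and>
      fst (s' 6) = fst (dtape L (digit (result L)) 0)"
    unfolding L_def q_def result_def
    by (rule runs_greedy[OF last_prime(1) \<open>0 < bitlen x\<close>])
      (use last_prime(2)[of "bitlen x"] last_prime(3)[of _ "bitlen x"] in \<open>simp_all add:
          result_def\<close>)
  then obtain s' where s': "runs greedy (start x) (4 * L + 21 + q * Suc (round_time q (bitlen (q *
      result L)))) s'"
      "fst (s' 6) = fst (dtape L (digit (result L)) 0)"
    by blast
  then obtain t where t: "t \<le> 4 * L + 21 + q * Suc (round_time q (bitlen (q * result L)))"
      "exec greedy (start x) t s'"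
    by (auto simp: runs_def)
  note out = exec_outcome[OF wf_machine t(2)]
  show halts: "halts machine x" by (rule out(1))
  show "run_time machine x \<le> 4 * L + 21 + q * Suc (round_time q (bitlen (q * result L)))"
    using out(2) t(1) by simp
  show "outputs machine x (result L)" if "bitlen (result L) = L"
    unfolding outputs_def using halts out(3) s'(2) tape_word_bin[of "result L" 0] that by simp
qed

lemma halts_machine: "halts machine x"
proof (cases "x = 0")
  case True
  then show ?thesis
    using runs_prog_0 exec_outcome(1)[OF wf_machine] by (auto simp: runs_def)
next
  case False
  then show ?thesis using machine_outcome(1) by simp
qed

lemma total_time_bound:
  assumes "q \<le> Q" and "n \<le> Q" and "L \<le> Q" and "1 \<le> Q"
  shows "4 * L + 21 + q * Suc (round_time q n) \<le> 234 * Q ^ 4"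
proof -
  have pw: "Q ^ i \<le> Q ^ j" if "i \<le> j" for i j
    using assms(4) that by (intro power_increasing) auto
  have "round_time q n \<le> Q * (2 * Q * Q + 11 * Q + 32) + Q * (60 * Q + 57) + 46"
    unfolding round_time_def using assms by (intro add_mono mult_mono) auto
  also have "\<dots> = 2 * Q ^ 3 + 71 * Q ^ 2 + 89 * Q ^ 1 + 46 * Q ^ 0"
    by (simp add: algebra_simps power2_eq_square power3_eq_cube)
  \<comment> \<open>\<open>208 = 2 + 71 + 89 + 46\<close>; one more for \<open>Suc\<close>, and then
    \<open>4 + 21\<close>, lead to \<open>234\<close>.\<close>
  also have "\<dots> \<le> 208 * Q ^ 3"
    using pw[of 2 3] pw[of 1 3] pw[of 0 3] by linarith
  finally have "Suc (round_time q n) \<le> 209 * Q ^ 3"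
    using pw[of 0 3] by simp
  then have "q * Suc (round_time q n) \<le> Q * (209 * Q ^ 3)"
    using assms(1) by (intro mult_le_mono) auto
  also have "\<dots> = 209 * Q ^ 4" using power_Suc[of Q 3] by simp
  finally show ?thesis
    using pw[of 1 4] pw[of 0 4] assms(3) by simp
qed

lemma bitlen_bounds:
  assumes "0 < x"
  shows "log 2 (real x) \<le> real (bitlen x)" and "real (bitlen x) \<le> log 2 (real x) + 1"
    and "2 ^ (bitlen x - 1) \<le> x" and "x < 2 ^ bitlen x"
proof -
  have L: "0 < bitlen x" using assms less_bitlen_iff[of 0 x] by simp
  show lt: "x < 2 ^ bitlen x" using bitlen_le_iff[of x "bitlen x"] by simp
  show ge: "2 ^ (bitlen x - 1) \<le> x" using le_bitlen_iff[OF L, of x] by simp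
  have "log 2 (real x) \<le> log 2 (real (2 ^ bitlen x))"
    using lt assms by (intro log_mono) (auto intro: less_imp_le simp del: of_nat_power)
  then show "log 2 (real x) \<le> real (bitlen x)" by simp
  have "log 2 (real (2 ^ (bitlen x - 1))) \<le> log 2 (real x)"
    using ge by (intro log_mono) (auto simp del: of_nat_power)
  then have "real (bitlen x - 1) \<le> log 2 (real x)" by simp
  then show "real (bitlen x) \<le> log 2 (real x) + 1" using L by linarith
qed

text \<open>For large \<open>x\<close>, \<open>33 * L ^ 4\<close> bounds the last prime
  \<open>q\<close>, the length \<open>L\<close> and the length, at most \<open>q + L\<close>, of the
  largest trial product. The time is of fourth order in this, hence of order \<open>L ^ 16\<close>,
  and \<open>L \<le> 2 * log 2 x\<close> gives the factor \<open>2 ^ 16\<close>.\<close>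

lemma poly_time_machine: "poly_time machine"
  unfolding poly_time_def
proof (intro conjI exI)
  show "\<forall>x. halts machine x" using halts_machine by blast
  have "\<forall>\<^sub>F x in at_top. norm (real (run_time machine x)) \<le>
      (234 * 33 ^ 4 * 2 ^ 16) * norm (log 2 (real x) ^ 16)"
    using eventually_compose_filterlim[OF eventually_result_facts filterlim_bitlen]
      eventually_ge_at_top[of 2]
  proof eventually_elim
    case (elim x)
    let ?L = "bitlen x" and ?q = "last_prime (bitlen x)"
    have x: "0 < x" using elim(2) by simp
    have "0 < ?L" using x less_bitlen_iff[of 0 x] by simp
    have q: "?q \<le> 32 * ?L ^ 4" and bitlen: "bitlen (result ?L) = ?L" using elim(1) by auto
    have "?L ^ 1 \<le> ?L ^ 4" using \<open>0 < ?L\<close> by (intro power_increasing) auto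
    then have L: "?L \<le> ?L ^ 4" by simp
    have "?q * result ?L < 2 ^ ?q * 2 ^ ?L"
      using bitlen bitlen_le_iff[of "result ?L" ?L] less_exp[of ?q] by (intro mult_strict_mono) auto
    then have "bitlen (?q * result ?L) \<le> ?q + ?L"
      by (simp add: bitlen_le_iff power_add)
    then have n: "bitlen (?q * result ?L) \<le> 33 * ?L ^ 4" using q L by linarith
    have "run_time machine x \<le> 234 * (33 * ?L ^ 4) ^ 4"
      using machine_outcome(2)[OF x]
        total_time_bound[of ?q "33 * ?L ^ 4" "bitlen (?q * result ?L)" ?L] q n L \<open>0 < ?L\<close> by simp
    also have "\<dots> = 234 * 33 ^ 4 * ?L ^ 16"
      by (simp add: power_mult_distrib flip: power_mult)
    finally have "real (run_time machine x) \<le> real (234 * 33 ^ 4 * ?L ^ 16)"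
      by (rule of_nat_mono)
    also have "\<dots> = 234 * 33 ^ 4 * real ?L ^ 16" by simp
    also have "\<dots> \<le> 234 * 33 ^ 4 * (2 * log 2 (real x)) ^ 16"
    proof -
      have "1 \<le> log 2 (real x)" using elim(2) by (simp add: le_log_iff)
      then have "real ?L \<le> 2 * log 2 (real x)" using bitlen_bounds(2)[OF x] by linarith
      then show ?thesis by (intro mult_left_mono power_mono) auto
    qed
    also have "\<dots> = (234 * 33 ^ 4 * 2 ^ 16) * log 2 (real x) ^ 16"
      by (simp add: power_mult_distrib)
    finally show ?case using elim(2) by simp
  qed
  then show "(\<lambda>x. real (run_time machine x)) \<in> O(\<lambda>x. log 2 (real x) ^ 16)"
    by (rule bigoI)
qed

section \<open>The order of the totient ratio\<close>

lemma ln_bounds_log: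
  assumes "1 \<le> (t :: real)"
  shows "ln t \<le> log 2 t" and "log 2 t \<le> 2 * ln t"
proof -
  have "1 / 2 \<le> ln (2 :: real)"
    using ln_le_minus_one[of "1 / 2 :: real"] by (simp add: ln_div)
  moreover have "ln (2 :: real) \<le> 1" using ln_2_less_1 by simp
  moreover have "0 \<le> ln t" using assms by simp
  ultimately have "ln t * ln 2 \<le> ln t" "ln t * 1 \<le> ln t * (2 * ln 2)"
    by (intro mult_left_le mult_left_mono; simp)+
  then show "ln t \<le> log 2 t" "log 2 t \<le> 2 * ln t"
    by (auto simp: log_def field_simps)
qed

theorem lemma2p10:
  shows "\<exists>(M :: tm) (m :: nat \<Rightarrow> nat).
    wf_tm M \<and> poly_time M \<and>
    (\<forall>\<^sub>F x in at_top.
       outputs M x (m x) \<and>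
       (\<exists>S :: nat set. finite S \<and> (\<forall>p\<in>S. prime p) \<and> m x = (\<Prod>p\<in>S. p)) \<and>
       real x / 2 < real (m x) \<and> real (m x) < 2 * real x) \<and>
    (\<lambda>x :: nat. real (totient (m x)) / real (m x)) \<in> \<Theta>(\<lambda>x. 1 / log 2 (log 2 (real x)))"
proof (intro exI conjI)
  let ?m = "\<lambda>x. result (bitlen x)"
  note facts = eventually_compose_filterlim[OF eventually_result_facts filterlim_bitlen]
  show "wf_tm machine" by (rule wf_tm_of[OF wf_machine]) auto
  show "poly_time machine" by (rule poly_time_machine)
  show "\<forall>\<^sub>F x in at_top. outputs machine x (?m x) \<and>
       (\<exists>S :: nat set. finite S \<and> (\<forall>p\<in>S. prime p) \<and> ?m x = (\<Prod>p\<in>S. p)) \<and>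
       real x / 2 < real (?m x) \<and> real (?m x) < 2 * real x"
    using facts eventually_gt_at_top[of 0]
  proof eventually_elim
    case (elim x)
    let ?L = "bitlen x"
    have "0 < ?L" using elim(2) less_bitlen_iff[of 0 x] by simp
    then have two_pow: "(2::nat) ^ ?L = 2 * 2 ^ (?L - 1)" by (simp flip: power_Suc)
    have "2 ^ (?L - 1) \<le> ?m x" "?m x < 2 ^ ?L"
      using elim(1) le_bitlen_iff[OF \<open>0 < ?L\<close>, of "?m x"] bitlen_le_iff[of "?m x" ?L] by auto
    then have "x < 2 * ?m x" "?m x < 2 * x"
      using bitlen_bounds(3,4)[OF elim(2)] two_pow by linarith+
    then have "real x < real (2 * ?m x)" "real (?m x) < real (2 * x)"
      by (simp_all only: of_nat_less_iff)
    then show ?case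
      using machine_outcome(3)[OF elim(2)] elim(1) by auto
  qed
  show "(\<lambda>x. real (totient (?m x)) / real (?m x)) \<in> \<Theta>(\<lambda>x. 1 / log 2 (log 2 (real x)))"
  proof (rule bigthetaI')
    have log: "filterlim (\<lambda>x :: nat. log 2 (real x)) at_top at_top"
      by real_asymp
    \<comment> \<open>Here \<open>t\<close> stands for \<open>log 2 x\<close>: the output contains
      all primes below some \<open>y \<ge> (L - 1) / 4 \<ge> (t - 1) / 4\<close>.\<close>
    have "\<forall>\<^sub>F t :: real in at_top. ln t / 2 \<le> ln ((t - 1) / 4)"
      by real_asymp
    note ln_ge = eventually_compose_filterlim[OF this log]
    have "\<forall>\<^sub>F t :: real in at_top. 1 + ln (t + 1) \<le> 2 * ln t"
      by real_asymp
    note ln_le = eventually_compose_filterlim[OF this log]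
    note log_large = eventually_compose_filterlim[OF eventually_gt_at_top[of 10] log]
    show "\<forall>\<^sub>F x in at_top.
        exp (- 4) / 4 * norm (1 / log 2 (log 2 (real x))) \<le> norm (real (totient (?m x)) / real (?m
            x)) \<and>
        norm (real (totient (?m x)) / real (?m x)) \<le> 4 * norm (1 / log 2 (log 2 (real x)))"
      using facts ln_ge ln_le log_large eventually_gt_at_top[of 0]
    proof eventually_elim
      case (elim x)
      let ?L = "bitlen x" and ?l = "log 2 (real x)"
      have L: "?l \<le> real ?L" "real ?L \<le> ?l + 1" using bitlen_bounds[OF elim(5)] by auto
      have ln_pos: "0 < ln ?l" using elim(4) by simp
      have loglog: "ln ?l \<le> log 2 ?l" "log 2 ?l \<le> 2 * ln ?l"
        using ln_bounds_log[of ?l] elim(4) by auto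
      have "10 < ?L" using L(1) elim(4) by linarith
      have bitlen: "bitlen (?m x) = ?L" using elim(1) by simp
      then have m: "0 < ?m x" "?m x < 2 ^ ?L"
        using \<open>10 < ?L\<close> bitlen_le_iff[of "?m x" ?L] by (auto intro!: Nat.gr0I)
      \<comment> \<open>The constant comes from
        \<open>1 + ln L \<le> 2 * ln t \<le> 2 * log 2 t\<close> with
        \<open>t = log 2 x\<close>.\<close>
      have "exp (- 4) / 4 * (1 / log 2 ?l) = exp (- 4) / (2 * (2 * log 2 ?l))" by simp
      also have "\<dots> \<le> exp (- 4) / (2 * (1 + ln (real ?L)))"
      proof -
        have "ln (real ?L) \<le> ln (?l + 1)" using L \<open>10 < ?L\<close> by (intro ln_mono) auto
        moreover have "0 < 1 + ln (real ?L)" using \<open>10 < ?L\<close> by (simp add: add_pos_nonneg)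
        ultimately show ?thesis
          using elim(3) loglog by (intro divide_left_mono mult_left_mono) auto
      qed
      also have "\<dots> \<le> real (totient (?m x)) / real (?m x)"
        using m \<open>10 < ?L\<close> by (intro totient_ratio_ge) auto
      finally have lower: "exp (- 4) / 4 * (1 / log 2 ?l) \<le> real (totient (?m x)) / real (?m x)" .
      obtain y where y: "?L \<le> 4 * y + 1" "\<forall>p. prime p \<longrightarrow> p < y \<longrightarrow> p dvd ?m x"
        using elim(1) by blast
      have "real (totient (?m x)) / real (?m x) \<le> 1 / ln (real y)"
        using m(1) y \<open>10 < ?L\<close> by (intro totient_ratio_le) auto
      \<comment> \<open>One factor 2 is lost in passing from \<open>y\<close> to
        \<open>log 2 x\<close>, the other in passing from \<open>ln\<close> to
        \<open>log 2\<close>.\<close>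
      also have "\<dots> \<le> 1 / (log 2 ?l / 4)"
      proof (rule divide_left_mono)
        have "real ?L \<le> 4 * real y + 1" using y(1) by linarith
        then have "(?l - 1) / 4 \<le> real y" using L(1) by simp
        then have "ln ((?l - 1) / 4) \<le> ln (real y)"
          using elim(4) by (intro ln_mono) auto
        then show *: "log 2 ?l / 4 \<le> ln (real y)" using elim(2) loglog by linarith
        show "0 < ln (real y) * (log 2 ?l / 4)" using * loglog ln_pos by (intro mult_pos_pos)
            linarith+
      qed simp
      finally have "real (totient (?m x)) / real (?m x) \<le> 4 * (1 / log 2 ?l)" by simp
      with lower show ?case using loglog ln_pos by simp
    qed
  qed auto
qed

end
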